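(* In the setting and notation of the context, suppose Assumptions A and D (stated in the context) are satisfied, that $r_n(\widehat\theta_n(\mathsf{x})-\theta_0(\mathsf{x}))=O_{\mathbb{P}}(1)$, and that the tuning parameter $\epsilon_n>0$ satisfies $\epsilon_n\to0$ and $n\epsilon_n^{1+2q}\to\infty$. If $\widetilde{\mathcal{D}}_{q,n}\in\{\widetilde{\mathcal{D}}^{\mathtt{MA}}_{q,n},\widetilde{\mathcal{D}}^{\mathtt{FD}}_{q,n}\}$, then $$\widetilde{\mathcal{D}}_{q,n}(\mathsf{x})\to_{\mathbb{P}}\mathcal{D}_q(\mathsf{x}),$$ and the function $\widetilde M_{\mathsf{x},n}(v)=\widetilde{\mathcal{D}}_{q,n}(\mathsf{x})\,v^{q+1}$ satisfies: $\widetilde M^q_{\mathsf{x},n}\rightsquigarrow_{\mathbb{P}}\mathcal{M}^q_{\mathsf{x}}$, where $\widetilde M^q_{\mathsf{x},n}(v)=\sqrt{na_n}\,\widetilde M_{\mathsf{x},n}(va_n^{-1})$, and, for some $c>0$ and every $K>0$, $$\liminf_{n\to\infty}\mathbb{P}\left[\inf_{|v|>K^{-1}}\widetilde M_{\mathsf{x},n}(v)\ge cK^{-(q+1)}\right]=1.$$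
   Context: **Conventions.** Limits are as $n\to\infty$. $\mathsf{GCM}_J(f)$ is the greatest convex minorant of $f$ on $J$; $\partial_-$ is the left derivative; $\partial^j$ is the $j$th derivative. For $f:I\to\mathbb{R}$ non-decreasing and right-continuous, $f^-(y)=\inf\{u\in I: f(u)\ge y\}$ (with $\inf\emptyset=\sup I$). $\lfloor a\rfloor$ is the integer part. $\rightsquigarrow_{\mathbb{P}}$ is weak convergence in probability conditionally on the data, in the topology of uniform convergence on compacta (for a function of the data alone converging to a deterministic function this is convergence in probability, uniformly on compacta). **Setup.** $I\subseteq\mathbb{R}$ is an interval, $\mathsf{x}$ an interior point of $I$, $\theta_0:I\to\mathbb{R}$ is non-decreasing, $\Phi_0$ is non-negative, non-decreasing and continuous on $I$, $\psi_0=\theta_0\circ\Phi_0^-$, $\Psi_0(x)=\int_0^x\psi_0(v)\,dv$, $\Gamma_0=\Psi_0\circ\Phi_0$. Let $q=\min\{j\in\{1,2,\dots\}:\partial^j\theta_0(\mathsf{x})\ne0\}$, $r_n=n^{q/(1+2q)}$, $a_n=n^{1/(1+2q)}$. Given estimators $(\widehat\Gamma_n,\widehat\Phi_n,\widehat u_n)$ (with $\widehat\Phi_n$ non-negative, non-decreasing, right-continuous on $I$), $$\widehat\theta_n(\mathsf{x})=\partial_-\mathsf{GCM}_{[0,\widehat u_n]}(\widehat\Gamma_n\circ\widehat\Phi_n^-)\circ\widehat\Phi_n(\mathsf{x}),\qquad \widehat\Upsilon_n=\widehat\Gamma_n-\widehat\theta_n(\mathsf{x})\widehat\Phi_n.$$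 Define $\mathcal{D}_q(\mathsf{x})=\partial^q\theta_0(\mathsf{x})\,\partial\Phi_0(\mathsf{x})/(q+1)!$, $\mathcal{M}^q_{\mathsf{x}}(v)=\mathcal{D}_q(\mathsf{x})v^{q+1}$, and the estimators $$\widetilde{\mathcal{D}}^{\mathtt{MA}}_{q,n}(\mathsf{x})=\epsilon_n^{-(q+1)}[\widehat\Upsilon_n(\mathsf{x}+\epsilon_n)-\widehat\Upsilon_n(\mathsf{x})],\qquad \widetilde{\mathcal{D}}^{\mathtt{FD}}_{q,n}(\mathsf{x})=\epsilon_n^{-(q+1)}\sum_{k=1}^{q+1}(-1)^{k+q+1}\binom{q+1}{k}[\widehat\Upsilon_n(\mathsf{x}+k\epsilon_n)-\widehat\Upsilon_n(\mathsf{x})].$$ For $\eta>0$ let $$\widehat G_n(v;\eta)=\sqrt{n\eta^{-1}}\,[\widehat\Gamma_n(\mathsf{x}+v\eta)-\widehat\Gamma_n(\mathsf{x})-\Gamma_0(\mathsf{x}+v\eta)+\Gamma_0(\mathsf{x})]-\theta_0(\mathsf{x})\sqrt{n\eta^{-1}}\,[\widehat\Phi_n(\mathsf{x}+v\eta)-\widehat\Phi_n(\mathsf{x})-\Phi_0(\mathsf{x}+v\eta)+\Phi_0(\mathsf{x})],$$ $$\widehat R_n(v;\eta)=\eta^{-1}[\widehat\Phi_n(\mathsf{x}+v\eta)-\widehat\Phi_n(\mathsf{x})-\Phi_0(\mathsf{x}+v\eta)+\Phi_0(\mathsf{x})].$$ **Assumption A.** For some $\delta>0$ and some real $s\ge q$,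 with $I^\delta_{\mathsf{x}}=\{x:|x-\mathsf{x}|\le\delta\}$: (A1) $I$ is an interval and $I^\delta_{\mathsf{x}}\subseteq I$. (A2) $\theta_0$ is non-decreasing and bounded on $I$, and $\lfloor s\rfloor$ times continuously differentiable on $I^\delta_{\mathsf{x}}$ with $\sup_{x,x'\in I^\delta_{\mathsf{x}}}|\partial^{\lfloor s\rfloor}\theta_0(x)-\partial^{\lfloor s\rfloor}\theta_0(x')|/|x-x'|^{s-\lfloor s\rfloor}<\infty$. (A3) $\Phi_0$ is non-negative, non-decreasing, continuous and bounded on $I$, and $\lfloor s\rfloor-q+1$ times continuously differentiable on $I^\delta_{\mathsf{x}}$ with $\partial\Phi_0(\mathsf{x})\ne0$ and $\sup_{x,x'\in I^\delta_{\mathsf{x}}}|\partial^{\lfloor s\rfloor-q+1}\Phi_0(x)-\partial^{\lfloor s\rfloor-q+1}\Phi_0(x')|/|x-x'|^{s-\lfloor s\rfloor}<\infty$. **Assumption D.** For every sequence $\eta_n>0$ with $\eta_n=o(1)$ and $a_n^{-1}\eta_n^{-1}=O(1)$: $\widehat G_n(1;\eta_n)=O_{\mathbb{P}}(1)$ and $\widehat R_n(1;\eta_n)=O_{\mathbb{P}}(1)$.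
   Formalization: The forward-difference estimator is divided by (q+1)!; as printed it converges to (q+1)! D_q(x) rather than D_q(x) (e.g. θ_0(t)=Φ_0(t)=t on [0,1], x=1/2, exact estimators: FD = 1 but D_1 = 1/2). *)

theory Defs
  imports "HOL-Probability.Probability"
begin

section \<open>Analytic notions\<close>

text \<open>
  The generalized inverse of \<open>f\<close> on \<open>I\<close>. If the set of those \<open>u \<in> I\<close> with \<open>y \<le> f u\<close> is all of an
  interval \<open>I\<close> without lower bound, the real infimum is an unspecified constant. For
  \<open>Phi0\<close> this happens only for \<open>y\<close> below all values of \<open>Phi0\<close>, so it affects \<open>Gamma0\<close> below
  by an additive constant, and only increments of \<open>Gamma0\<close> are ever used.
\<close>
definition gen_inv :: "real set \<Rightarrow> (real \<Rightarrow> real) \<Rightarrow> real \<Rightarrow> real" where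
  "gen_inv I f y = (if {u \<in> I. y \<le> f u} = {} then Sup I else Inf {u \<in> I. y \<le> f u})"

definition gcm :: "real set \<Rightarrow> (real \<Rightarrow> real) \<Rightarrow> real \<Rightarrow> real" where
  "gcm J f t = (SUP g\<in>{g. convex_on J g \<and> (\<forall>y\<in>J. g y \<le> f y)}. g t)"

definition left_deriv :: "(real \<Rightarrow> real) \<Rightarrow> real \<Rightarrow> real" where
  "left_deriv f t = vector_derivative f (at_left t)"

text \<open>
  Iterated derivatives relative to \<open>S\<close> (one-sided at the end points of a closed interval); at
  interior points of \<open>S\<close> they are the usual iterated derivatives.
\<close>
definition iter_deriv_on :: "real set \<Rightarrow> nat \<Rightarrow> (real \<Rightarrow> real) \<Rightarrow> real \<Rightarrow> real" where
  "iter_deriv_on S k f = ((\<lambda>g y. vector_derivative g (at y within S)) ^^ k) f"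

definition Ck_on :: "real set \<Rightarrow> nat \<Rightarrow> (real \<Rightarrow> real) \<Rightarrow> bool" where
  "Ck_on S k f \<longleftrightarrow> (\<forall>j<k. iter_deriv_on S j f differentiable_on S)
     \<and> continuous_on S (iter_deriv_on S k f)"

text \<open>On the diagonal the quotient is \<open>0 / 0 = 0\<close>, so it does not contribute to the supremum.\<close>
definition holder_on :: "real set \<Rightarrow> real \<Rightarrow> (real \<Rightarrow> real) \<Rightarrow> bool" where
  "holder_on S \<alpha> f \<longleftrightarrow>
     bdd_above ((\<lambda>(y, y'). \<bar>f y - f y'\<bar> / \<bar>y - y'\<bar> powr \<alpha>) ` (S \<times> S))"

section \<open>Stochastic order and convergence\<close>

definition bounded_in_prob :: "'w measure \<Rightarrow> (nat \<Rightarrow> 'w \<Rightarrow> real) \<Rightarrow> bool" where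
  "bounded_in_prob M X \<longleftrightarrow>
     (\<forall>e>0. \<exists>K. \<forall>\<^sub>F n in sequentially. measure M {\<omega> \<in> space M. \<bar>X n \<omega>\<bar> > K} \<le> e)"

definition tendsto_in_prob :: "'w measure \<Rightarrow> (nat \<Rightarrow> 'w \<Rightarrow> real) \<Rightarrow> real \<Rightarrow> bool" where
  "tendsto_in_prob M X l \<longleftrightarrow>
     (\<forall>e>0. (\<lambda>n. measure M {\<omega> \<in> space M. \<bar>X n \<omega> - l\<bar> > e}) \<longlonglongrightarrow> 0)"

text \<open>
  Random functions that depend on the data alone and have a deterministic limit: conditional weak
  convergence in probability, for the topology of uniform convergence on compacta, is
  convergence in probability uniformly on compacta.
\<close>
definition tendsto_in_prob_compacta ::
    "'w measure \<Rightarrow> (nat \<Rightarrow> 'w \<Rightarrow> real \<Rightarrow> real) \<Rightarrow> (real \<Rightarrow> real) \<Rightarrow> bool" where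
  "tendsto_in_prob_compacta M X f \<longleftrightarrow>
     (\<forall>C. compact C \<and> C \<noteq> {} \<longrightarrow> tendsto_in_prob M (\<lambda>n \<omega>. SUP v\<in>C. \<bar>X n \<omega> v - f v\<bar>) 0)"

section \<open>Population quantities\<close>

definition psi0 :: "real set \<Rightarrow> (real \<Rightarrow> real) \<Rightarrow> (real \<Rightarrow> real) \<Rightarrow> real \<Rightarrow> real" where
  "psi0 I \<theta>\<^sub>0 \<Phi>\<^sub>0 = \<theta>\<^sub>0 \<circ> gen_inv I \<Phi>\<^sub>0"

definition Psi0 :: "real set \<Rightarrow> (real \<Rightarrow> real) \<Rightarrow> (real \<Rightarrow> real) \<Rightarrow> real \<Rightarrow> real" where
  "Psi0 I \<theta>\<^sub>0 \<Phi>\<^sub>0 y = integral {0..y} (psi0 I \<theta>\<^sub>0 \<Phi>\<^sub>0)"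

definition Gamma0 :: "real set \<Rightarrow> (real \<Rightarrow> real) \<Rightarrow> (real \<Rightarrow> real) \<Rightarrow> real \<Rightarrow> real" where
  "Gamma0 I \<theta>\<^sub>0 \<Phi>\<^sub>0 = Psi0 I \<theta>\<^sub>0 \<Phi>\<^sub>0 \<circ> \<Phi>\<^sub>0"

definition Dq :: "nat \<Rightarrow> (real \<Rightarrow> real) \<Rightarrow> (real \<Rightarrow> real) \<Rightarrow> real \<Rightarrow> real" where
  "Dq q \<theta>\<^sub>0 \<Phi>\<^sub>0 x = (deriv ^^ q) \<theta>\<^sub>0 x * deriv \<Phi>\<^sub>0 x / fact (q + 1)"

definition r_rate :: "nat \<Rightarrow> nat \<Rightarrow> real" where
  "r_rate q n = real n powr (real q / (1 + 2 * real q))"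

definition a_rate :: "nat \<Rightarrow> nat \<Rightarrow> real" where
  "a_rate q n = real n powr (1 / (1 + 2 * real q))"

section \<open>Estimators\<close>

text \<open>
  In this section \<open>\<Gamma>\<close>, \<open>\<Phi>\<close> and \<open>u\<close> are realizations, for a fixed sample, of the estimators.
\<close>
definition theta_hat ::
    "real set \<Rightarrow> (real \<Rightarrow> real) \<Rightarrow> (real \<Rightarrow> real) \<Rightarrow> real \<Rightarrow> real \<Rightarrow> real" where
  "theta_hat I \<Gamma> \<Phi> u x = left_deriv (gcm {0..u} (\<Gamma> \<circ> gen_inv I \<Phi>)) (\<Phi> x)"

definition Upsilon_hat ::
    "real set \<Rightarrow> (real \<Rightarrow> real) \<Rightarrow> (real \<Rightarrow> real) \<Rightarrow> real \<Rightarrow> real \<Rightarrow> real \<Rightarrow> real" where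
  "Upsilon_hat I \<Gamma> \<Phi> u x t = \<Gamma> t - theta_hat I \<Gamma> \<Phi> u x * \<Phi> t"

definition D_MA ::
    "nat \<Rightarrow> real set \<Rightarrow> (real \<Rightarrow> real) \<Rightarrow> (real \<Rightarrow> real) \<Rightarrow> real \<Rightarrow> real \<Rightarrow> real \<Rightarrow> real" where
  "D_MA q I \<Gamma> \<Phi> u x \<epsilon> =
     (Upsilon_hat I \<Gamma> \<Phi> u x (x + \<epsilon>) - Upsilon_hat I \<Gamma> \<Phi> u x x) / \<epsilon> ^ (q + 1)"

text \<open>
  This is the raw forward difference quotient. Since
  \<open>(\<Sum>k=1..q+1. (-1)^(k+q+1) * (q+1 choose k) * k^(q+1)) = fact (q+1)\<close>, it is
  \<open>D_FD / fact (q + 1)\<close>, rather than \<open>D_FD\<close> itself, that estimates \<open>Dq\<close>.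
\<close>
definition D_FD ::
    "nat \<Rightarrow> real set \<Rightarrow> (real \<Rightarrow> real) \<Rightarrow> (real \<Rightarrow> real) \<Rightarrow> real \<Rightarrow> real \<Rightarrow> real \<Rightarrow> real" where
  "D_FD q I \<Gamma> \<Phi> u x \<epsilon> =
     (\<Sum>k=1..q+1. (-1) ^ (k + q + 1) * real ((q + 1) choose k) *
        (Upsilon_hat I \<Gamma> \<Phi> u x (x + real k * \<epsilon>) - Upsilon_hat I \<Gamma> \<Phi> u x x)) / \<epsilon> ^ (q + 1)"

definition G_hat ::
    "real set \<Rightarrow> (real \<Rightarrow> real) \<Rightarrow> (real \<Rightarrow> real) \<Rightarrow> real \<Rightarrow> nat
     \<Rightarrow> (real \<Rightarrow> real) \<Rightarrow> (real \<Rightarrow> real) \<Rightarrow> real \<Rightarrow> real \<Rightarrow> real" where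
  "G_hat I \<theta>\<^sub>0 \<Phi>\<^sub>0 x n \<Gamma> \<Phi> v \<eta> =
     sqrt (real n / \<eta>) *
       (\<Gamma> (x + v * \<eta>) - \<Gamma> x - Gamma0 I \<theta>\<^sub>0 \<Phi>\<^sub>0 (x + v * \<eta>) + Gamma0 I \<theta>\<^sub>0 \<Phi>\<^sub>0 x)
     - \<theta>\<^sub>0 x * sqrt (real n / \<eta>) * (\<Phi> (x + v * \<eta>) - \<Phi> x - \<Phi>\<^sub>0 (x + v * \<eta>) + \<Phi>\<^sub>0 x)"

definition R_hat ::
    "(real \<Rightarrow> real) \<Rightarrow> real \<Rightarrow> (real \<Rightarrow> real) \<Rightarrow> real \<Rightarrow> real \<Rightarrow> real" where
  "R_hat \<Phi>\<^sub>0 x \<Phi> v \<eta> = (\<Phi> (x + v * \<eta>) - \<Phi> x - \<Phi>\<^sub>0 (x + v * \<eta>) + \<Phi>\<^sub>0 x) / \<eta>"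

section \<open>Assumptions\<close>

definition assumption_A ::
    "nat \<Rightarrow> real set \<Rightarrow> (real \<Rightarrow> real) \<Rightarrow> (real \<Rightarrow> real) \<Rightarrow> real \<Rightarrow> bool" where
  "assumption_A q I \<theta>\<^sub>0 \<Phi>\<^sub>0 x \<longleftrightarrow>
     (\<exists>\<delta>>0. \<exists>s\<ge>real q. let S = cball x \<delta>; m = nat \<lfloor>s\<rfloor>; \<alpha> = s - real m in
        is_interval I \<and> S \<subseteq> I \<and>
        mono_on I \<theta>\<^sub>0 \<and> bounded (\<theta>\<^sub>0 ` I) \<and>
        Ck_on S m \<theta>\<^sub>0 \<and> holder_on S \<alpha> (iter_deriv_on S m \<theta>\<^sub>0) \<and>
        (\<forall>t\<in>I. 0 \<le> \<Phi>\<^sub>0 t) \<and> mono_on I \<Phi>\<^sub>0 \<and> continuous_on I \<Phi>\<^sub>0 \<and> bounded (\<Phi>\<^sub>0 ` I) \<and>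
        Ck_on S (m - q + 1) \<Phi>\<^sub>0 \<and> deriv \<Phi>\<^sub>0 x \<noteq> 0 \<and>
        holder_on S \<alpha> (iter_deriv_on S (m - q + 1) \<Phi>\<^sub>0))"

definition assumption_D ::
    "'w measure \<Rightarrow> nat \<Rightarrow> real set \<Rightarrow> (real \<Rightarrow> real) \<Rightarrow> (real \<Rightarrow> real) \<Rightarrow> real
     \<Rightarrow> (nat \<Rightarrow> 'w \<Rightarrow> real \<Rightarrow> real) \<Rightarrow> (nat \<Rightarrow> 'w \<Rightarrow> real \<Rightarrow> real) \<Rightarrow> bool" where
  "assumption_D M q I \<theta>\<^sub>0 \<Phi>\<^sub>0 x \<Gamma> \<Phi> \<longleftrightarrow>
     (\<forall>\<eta> :: nat \<Rightarrow> real. (\<forall>n. \<eta> n > 0) \<longrightarrow> \<eta> \<longlonglongrightarrow> 0 \<longrightarrow>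
        (\<lambda>n. inverse (a_rate q n) * inverse (\<eta> n)) \<in> O(\<lambda>_. 1) \<longrightarrow>
        bounded_in_prob M (\<lambda>n \<omega>. G_hat I \<theta>\<^sub>0 \<Phi>\<^sub>0 x n (\<Gamma> n \<omega>) (\<Phi> n \<omega>) 1 (\<eta> n)) \<and>
        bounded_in_prob M (\<lambda>n \<omega>. R_hat \<Phi>\<^sub>0 x (\<Phi> n \<omega>) 1 (\<eta> n)))"

end

theory Submission
  imports Defs
begin

text \<open>
  Write \<open>H = Gamma0 - \<theta>\<^sub>0 x * \<Phi>\<^sub>0\<close>. Near \<open>x\<close> its derivative \<open>(\<theta>\<^sub>0 t - \<theta>\<^sub>0 x) * deriv \<Phi>\<^sub>0 t\<close> has leading term
  of order \<open>(t - x) ^ q\<close>, so \<open>(H (x + \<eta>) - H x) / \<eta> ^ (q + 1)\<close> tends to \<open>Dq\<close>; monotonicity of \<open>\<theta>\<^sub>0\<close> and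
  \<open>\<Phi>\<^sub>0\<close> forces \<open>q\<close> to be odd and \<open>Dq > 0\<close>. The monomial estimator with step \<open>\<eta>\<close> differs from this
  quotient by the noise \<open>G_hat / sqrt (n * \<eta> ^ (1 + 2 * q))\<close> and by
  \<open>(theta_hat - \<theta>\<^sub>0 x) * (R_hat + O(1)) / \<eta> ^ q\<close>, which is a product of stochastically bounded factors
  with \<open>(n * \<eta> ^ (1 + 2 * q)) powr (- q / (1 + 2 * q))\<close>; both vanish. The forward difference
  estimator is a fixed linear combination of monomial estimators with steps \<open>k * \<epsilon>\<close>, whose weights
  add up to one. Since \<open>q + 1\<close> is even, the lower bound for \<open>D * v ^ (q + 1)\<close> amounts to
  \<open>D \<ge> Dq / 2\<close> with probability tending to one.
\<close>

section \<open>Alternating binomial sums of powers\<close>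

text \<open>Up to sign this is the \<open>n\<close>-th finite difference at 0 of a monomial of
  degree at most \<open>n\<close>. In the induction,
  \<open>k * (Suc n choose k) = Suc n * (n choose (k - 1))\<close> absorbs one factor
  \<open>k\<close>; expanding the shifted power leaves sums for \<open>n\<close>, of which only the
  top power survives.\<close>

lemma alternating_sum_binomial_powers:
  "j \<le> n \<Longrightarrow> (\<Sum>k\<le>n. (-1) ^ k * of_nat (n choose k) * of_nat k ^ j) =
     (if j = n then (-1) ^ n * fact n else (0 :: 'a::{comm_ring_1, semiring_char_0}))"
proof (induction n arbitrary: j)
  case 0
  then show ?case by simp
next
  case (Suc n)
  show ?case
  proof (cases j)
    case 0
    then show ?thesis using choose_alternating_sum[of "Suc n", where 'a='a] by simp
  next
    case (Suc i)
    then have i: "i \<le> n" using Suc.prems by simp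
    \<comment> \<open>The term \<open>k = 0\<close> drops out because
      \<open>0 ^ Suc i = 0\<close>.\<close>
    have "(\<Sum>k\<le>Suc n. (-1) ^ k * of_nat (Suc n choose k) * of_nat k ^ j) =
        (\<Sum>k\<le>n. (-1) ^ Suc k * of_nat (Suc n choose Suc k) * of_nat (Suc k) ^ Suc i :: 'a)"
      by (simp add: sum.atMost_Suc_shift Suc del: sum.atMost_Suc binomial_Suc_Suc)
    also have "\<dots> = (\<Sum>k\<le>n. - of_nat (Suc n) * ((-1) ^ k * of_nat (n choose k) * (of_nat k + 1) ^ i))"
    proof (intro sum.cong refl)
      fix k
      have "of_nat (Suc k) * of_nat (Suc n choose Suc k) = (of_nat (Suc n) * of_nat (n choose k) :: 'a)"
        using Suc_times_binomial_eq[of n k] by (metis mult.commute of_nat_mult)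
      moreover have "a * c = N * b \<Longrightarrow> - s * c * (a * p) = - N * (s * b * p)" for a b c s p N :: 'a
        by (metis (no_types, opaque_lifting) mult.assoc mult.left_commute mult_minus_left)
      ultimately show "(-1) ^ Suc k * of_nat (Suc n choose Suc k) * of_nat (Suc k) ^ Suc i =
          - of_nat (Suc n) * ((-1) ^ k * of_nat (n choose k) * (of_nat k + 1) ^ i :: 'a)"
        by (simp only: power_Suc mult_minus1 of_nat_Suc add.commute)
    qed
    also have "\<dots> = - of_nat (Suc n) * (\<Sum>k\<le>n. \<Sum>l\<le>i. of_nat (i choose l) *
        ((-1) ^ k * of_nat (n choose k) * of_nat k ^ l))"
      unfolding sum_distrib_left[symmetric] binomial_ring
      by (simp add: sum_distrib_left mult_ac)
    also have "\<dots> = - of_nat (Suc n) * (\<Sum>l\<le>i. of_nat (i choose l) *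
        (\<Sum>k\<le>n. (-1) ^ k * of_nat (n choose k) * of_nat k ^ l))"
      by (subst sum.swap) (simp add: sum_distrib_left)
    also have "\<dots> = - of_nat (Suc n) * (\<Sum>l\<le>i. if l = n then of_nat (i choose l) * ((-1) ^ n * fact n) else 0)"
      using i by (intro arg_cong[where f="\<lambda>z. - of_nat (Suc n) * z"] sum.cong refl) (simp add: Suc.IH)
    also have "\<dots> = (if j = Suc n then (-1) ^ Suc n * fact (Suc n) else 0)"
      using i Suc by (auto simp: sum.delta algebra_simps)
    finally show ?thesis .
  qed
qed

section \<open>The generalized inverse and the derivative of Gamma0\<close>

context
  fixes I :: "real set" and \<theta> \<Phi> :: "real \<Rightarrow> real"
  assumes I: "is_interval I"
    and mono_theta: "mono_on I \<theta>" and bounded_theta: "bounded (\<theta> ` I)"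
    and Phi_nonneg: "\<And>t. t \<in> I \<Longrightarrow> 0 \<le> \<Phi> t" and mono_Phi: "mono_on I \<Phi>"
begin

text \<open>By monotonicity the strict inequality on the left puts every competitor of the infimum
  to the right of \<open>t\<close>, while \<open>t'\<close> is itself a competitor. With equality on
  the left a flat stretch of \<open>\<Phi>\<close> could push the infimum below
  \<open>t\<close>.\<close>

lemma gen_inv_between:
  assumes "t \<in> I" "t' \<in> I" "\<Phi> t < y" "y \<le> \<Phi> t'"
  shows "t \<le> gen_inv I \<Phi> y" "gen_inv I \<Phi> y \<le> t'" "gen_inv I \<Phi> y \<in> I"
proof -
  have lower: "t \<le> u" if "u \<in> {u \<in> I. y \<le> \<Phi> u}" for u
    using that assms mono_onD[OF mono_Phi, of u t] by (cases "t \<le> u") auto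
  have eq: "gen_inv I \<Phi> y = Inf {u \<in> I. y \<le> \<Phi> u}"
    using assms by (auto simp: gen_inv_def)
  show 1: "t \<le> gen_inv I \<Phi> y"
    unfolding eq using assms lower by (intro cInf_greatest) auto
  show 2: "gen_inv I \<Phi> y \<le> t'"
    unfolding eq using assms lower by (intro cInf_lower bdd_belowI[of _ t]) auto
  show "gen_inv I \<Phi> y \<in> I"
    by (rule mem_is_interval_1_I[OF I assms(1,2) 1 2])
qed

text \<open>
  Below all values of \<open>\<Phi>\<close> the generalized inverse is the constant \<open>Inf I\<close>, which may lie outside
  \<open>I\<close>; there monotonicity of \<open>psi0\<close> can fail, so this part is split off.
\<close>
lemma psi0_integrable_on:
  assumes b: "b \<in> I"
  shows "psi0 I \<theta> \<Phi> integrable_on {0..\<Phi> b}"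
proof -
  let ?A = "\<lambda>y. {u \<in> I. y \<le> \<Phi> u}" and ?\<psi> = "psi0 I \<theta> \<Phi>"
  obtain B where B: "\<And>u. u \<in> I \<Longrightarrow> \<bar>\<theta> u\<bar> \<le> B"
    using bounded_theta unfolding bounded_iff by auto
  \<comment> \<open>The value \<open>- B\<close> is below all values of \<open>\<theta>\<close> on
    \<open>I\<close>, so \<open>g\<close> stays monotone where \<open>?A y\<close> stops being all
    of \<open>I\<close>.\<close>
  define g where "g y = (if ?A y = I then - B else ?\<psi> y)" for y
  \<comment> \<open>This monotone indicator makes the correction on the lower part integrable; there
    \<open>psi0\<close> is the constant \<open>\<theta> (Inf I)\<close>.\<close>
  define h where "h y = (if ?A y = I then 0 else 1 :: real)" for y
  have in_I: "gen_inv I \<Phi> y \<in> I" if y: "?A y \<noteq> I" "y \<le> \<Phi> b" for y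
  proof -
    obtain c where "c \<in> I" "\<Phi> c < y" using y(1) by (force simp: set_eq_iff not_le)
    then show ?thesis using gen_inv_between(3)[OF _ b] y by blast
  qed
  have "mono_on {0..\<Phi> b} g"
  proof (rule mono_onI)
    fix y y' assume y: "y \<in> {0..\<Phi> b}" "y' \<in> {0..\<Phi> b}" "y \<le> y'"
    have sub: "?A y' \<subseteq> ?A y" using y by auto
    consider "?A y' = I" "?A y = I" | "?A y' \<noteq> I" "?A y = I" | "?A y' \<noteq> I" "?A y \<noteq> I"
      using sub by auto
    then show "g y \<le> g y'"
    proof cases
      case 2
      then show ?thesis using B[OF in_I[of y']] y by (simp add: g_def psi0_def)
    next
      case 3
      obtain c where c: "c \<in> I" "\<Phi> c < y" using 3(2) by (force simp: set_eq_iff not_le)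
      have "bdd_below (?A y)"
      proof (rule bdd_belowI[of _ c])
        fix u assume "u \<in> ?A y"
        then show "c \<le> u" using c mono_onD[OF mono_Phi, of u c] by (cases "c \<le> u") auto
      qed
      moreover have "b \<in> ?A y'" using y b by auto
      ultimately have "gen_inv I \<Phi> y \<le> gen_inv I \<Phi> y'"
        using sub unfolding gen_inv_def by (auto intro!: cInf_superset_mono)
      then have "?\<psi> y \<le> ?\<psi> y'"
        using mono_theta in_I[of y] in_I[of y'] 3 y by (auto simp: psi0_def mono_on_def)
      then show ?thesis using 3 by (simp add: g_def)
    qed (simp add: g_def)
  qed
  then have "g integrable_on {0..\<Phi> b}"
    by (rule integrable_on_mono_on)
  moreover have "mono_on {0..\<Phi> b} h"
    by (rule mono_onI) (auto simp: h_def set_eq_iff intro: order_trans)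
  then have "h integrable_on {0..\<Phi> b}"
    by (rule integrable_on_mono_on)
  ultimately have "(\<lambda>y. g y + (B + \<theta> (Inf I)) * (1 - h y)) integrable_on {0..\<Phi> b}"
    by (intro integrable_add integrable_on_mult_right integrable_diff) auto
  moreover have "g y + (B + \<theta> (Inf I)) * (1 - h y) = ?\<psi> y" for y
    using b by (auto simp: g_def h_def psi0_def gen_inv_def)
  ultimately show ?thesis by simp
qed

text \<open>The increment is the integral of \<open>psi0\<close> over
  \<open>{\<Phi> t..\<Phi> t'}\<close>, and on that range, apart from the left end,
  \<open>psi0\<close> takes values of \<open>\<theta>\<close> at points between \<open>t\<close> and
  \<open>t'\<close>.\<close>

lemma Gamma0_increment_bounds:
  assumes t: "t \<in> I" and t': "t' \<in> I" and le: "t \<le> t'"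
  shows "\<theta> t * (\<Phi> t' - \<Phi> t) \<le> Gamma0 I \<theta> \<Phi> t' - Gamma0 I \<theta> \<Phi> t"
    and "Gamma0 I \<theta> \<Phi> t' - Gamma0 I \<theta> \<Phi> t \<le> \<theta> t' * (\<Phi> t' - \<Phi> t)"
proof -
  let ?\<psi> = "psi0 I \<theta> \<Phi>"
  have ord: "0 \<le> \<Phi> t" "\<Phi> t \<le> \<Phi> t'"
    using assms Phi_nonneg mono_Phi by (auto simp: mono_on_def)
  \<comment> \<open>At the left end \<open>y = \<Phi> t\<close> the generalized inverse can lie to
    the left of \<open>t\<close>, where the lower bound may fail; changing one value leaves the
    integral unchanged.\<close>
  define \<psi>' where "\<psi>' = ?\<psi>(\<Phi> t := \<theta> t)"
  have int: "?\<psi> integrable_on {\<Phi> t..\<Phi> t'}"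
    by (rule integrable_subinterval_real[OF psi0_integrable_on[OF t']]) (use ord in auto)
  have "Gamma0 I \<theta> \<Phi> t' - Gamma0 I \<theta> \<Phi> t = integral {\<Phi> t..\<Phi> t'} ?\<psi>"
    using Henstock_Kurzweil_Integration.integral_combine[OF ord psi0_integrable_on[OF t']]
    by (simp add: Gamma0_def Psi0_def)
  then have "(?\<psi> has_integral (Gamma0 I \<theta> \<Phi> t' - Gamma0 I \<theta> \<Phi> t)) {\<Phi> t..\<Phi> t'}"
    using int by (simp add: has_integral_iff)
  then have \<psi>': "(\<psi>' has_integral (Gamma0 I \<theta> \<Phi> t' - Gamma0 I \<theta> \<Phi> t)) {\<Phi> t..\<Phi> t'}"
    by (rule has_integral_spike[of "{\<Phi> t}", rotated 2]) (auto simp: \<psi>'_def)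
  have bounds: "\<theta> t \<le> \<psi>' y \<and> \<psi>' y \<le> \<theta> t'" if "y \<in> {\<Phi> t..\<Phi> t'}" for y
  proof (cases "y = \<Phi> t")
    case True
    then show ?thesis using assms mono_theta by (auto simp: \<psi>'_def mono_on_def)
  next
    case False
    then show ?thesis
      using gen_inv_between[OF t t', of y] that t t' mono_theta
      by (auto simp: \<psi>'_def psi0_def mono_on_def)
  qed
  have const: "((\<lambda>_. c) has_integral c * (\<Phi> t' - \<Phi> t)) {\<Phi> t..\<Phi> t'}" for c :: real
    using has_integral_const_real[of c "\<Phi> t" "\<Phi> t'"] ord by (simp add: mult.commute)
  show "\<theta> t * (\<Phi> t' - \<Phi> t) \<le> Gamma0 I \<theta> \<Phi> t' - Gamma0 I \<theta> \<Phi> t"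
    by (rule has_integral_le[OF const \<psi>']) (use bounds in auto)
  show "Gamma0 I \<theta> \<Phi> t' - Gamma0 I \<theta> \<Phi> t \<le> \<theta> t' * (\<Phi> t' - \<Phi> t)"
    by (rule has_integral_le[OF \<psi>' const]) (use bounds in auto)
qed

text \<open>The increment bounds give an error of at most \<open>\<bar>\<theta> y - \<theta> t\<bar>
  * \<bar>\<Phi> y - \<Phi> t\<bar>\<close> when the increment of \<open>Gamma0\<close> is replaced
  by \<open>\<theta> t * (\<Phi> y - \<Phi> t)\<close>. After division by \<open>y - t\<close> it
  vanishes by continuity of \<open>\<theta>\<close>, so the generalized inverse never has to be
  differentiated.\<close>

lemma Gamma0_has_real_derivative:
  assumes t: "t \<in> interior I" and cont: "isCont \<theta> t"
    and deriv: "(\<Phi> has_real_derivative D) (at t)"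
  shows "(Gamma0 I \<theta> \<Phi> has_real_derivative \<theta> t * D) (at t)"
proof -
  let ?G = "Gamma0 I \<theta> \<Phi>"
  let ?Q = "\<lambda>f y. (f y - f t) / (y - t)"
  have Phi: "(?Q \<Phi> \<longlongrightarrow> D) (at t)"
    using deriv by (simp add: has_field_derivative_iff)
  have tI: "t \<in> I" using t interior_subset by blast
  have ev: "\<forall>\<^sub>F y in at t. y \<in> I"
    using t by (metis eventually_at_topological interior_subset open_interior subsetD)
  have "\<forall>\<^sub>F y in at t. \<bar>?Q ?G y - \<theta> t * ?Q \<Phi> y\<bar> \<le> \<bar>\<theta> y - \<theta> t\<bar> * \<bar>?Q \<Phi> y\<bar>"
    using ev
  proof eventually_elim
    case (elim y)
    have "\<bar>?G y - ?G t - \<theta> t * (\<Phi> y - \<Phi> t)\<bar> \<le> \<bar>\<theta> y - \<theta> t\<bar> * \<bar>\<Phi> y - \<Phi> t\<bar>"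
    proof (cases "t \<le> y")
      case True
      have "\<theta> t \<le> \<theta> y" "\<Phi> t \<le> \<Phi> y"
        using True mono_theta mono_Phi tI elim by (auto simp: mono_on_def)
      then show ?thesis
        using Gamma0_increment_bounds[OF tI elim True] by (simp add: algebra_simps)
    next
      case False
      then have le: "y \<le> t" by simp
      have "\<theta> y \<le> \<theta> t" "\<Phi> y \<le> \<Phi> t"
        using le mono_theta mono_Phi tI elim by (auto simp: mono_on_def)
      then show ?thesis
        using Gamma0_increment_bounds[OF elim tI le] by (simp add: algebra_simps)
    qed
    then have "\<bar>?G y - ?G t - \<theta> t * (\<Phi> y - \<Phi> t)\<bar> / \<bar>y - t\<bar> \<le> \<bar>\<theta> y - \<theta> t\<bar> * \<bar>\<Phi> y - \<Phi> t\<bar> / \<bar>y - t\<bar>"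
      by (intro divide_right_mono) auto
    moreover have "?Q ?G y - \<theta> t * ?Q \<Phi> y = (?G y - ?G t - \<theta> t * (\<Phi> y - \<Phi> t)) / (y - t)"
      by (simp add: diff_divide_distrib right_diff_distrib)
    ultimately show ?case
      by (simp add: abs_divide)
  qed
  moreover have "((\<lambda>y. \<bar>\<theta> y - \<theta> t\<bar> * \<bar>?Q \<Phi> y\<bar>) \<longlongrightarrow> 0) (at t)"
  proof -
    have "((\<lambda>y. \<bar>\<theta> y - \<theta> t\<bar> * \<bar>?Q \<Phi> y\<bar>) \<longlongrightarrow> \<bar>\<theta> t - \<theta> t\<bar> * \<bar>D\<bar>) (at t)"
      using cont Phi unfolding isCont_def by (intro tendsto_intros)
    then show ?thesis by simp
  qed
  ultimately have "((\<lambda>y. ?Q ?G y - \<theta> t * ?Q \<Phi> y) \<longlongrightarrow> 0) (at t)"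
    unfolding real_norm_def[symmetric] by (rule Lim_null_comparison)
  from tendsto_add[OF this tendsto_mult_left[OF Phi, of "\<theta> t"]]
  show ?thesis by (simp add: has_field_derivative_iff)
qed

end

section \<open>Local expansion\<close>

text \<open>Connects the relative derivatives of \<open>Ck_on\<close> with the \<open>deriv\<close>
  iterates that define \<open>q\<close> and \<open>Dq\<close>: at interior points of
  \<open>S\<close> the filters \<open>at t within S\<close> and \<open>at t\<close> agree.\<close>

lemma iter_deriv_on_interior:
  assumes Ck: "Ck_on S k f" and t: "t \<in> interior S"
  shows "j < k \<Longrightarrow> (iter_deriv_on S j f has_real_derivative iter_deriv_on S (Suc j) f t) (at t)"
    and "j \<le> k \<Longrightarrow> (deriv ^^ j) f t = iter_deriv_on S j f t"
proof -
  have D: "(iter_deriv_on S j f has_real_derivative iter_deriv_on S (Suc j) f t) (at t)"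
    if "j < k" "t \<in> interior S" for j t
  proof -
    have "t \<in> S" using that(2) interior_subset by blast
    then have "iter_deriv_on S j f differentiable at t within S"
      using Ck that(1) by (auto simp: Ck_on_def differentiable_on_def)
    then show ?thesis
      unfolding vector_derivative_works at_within_interior[OF that(2)]
      by (simp add: iter_deriv_on_def at_within_interior[OF that(2)]
          has_real_derivative_iff_has_vector_derivative)
  qed
  show "j < k \<Longrightarrow> (iter_deriv_on S j f has_real_derivative iter_deriv_on S (Suc j) f t) (at t)"
    using D t by blast
  show "j \<le> k \<Longrightarrow> (deriv ^^ j) f t = iter_deriv_on S j f t"
    using t
  proof (induction j arbitrary: t)
    case (Suc j)
    \<comment> \<open>The next derivative depends on values near \<open>t\<close>, so the induction
      hypothesis is used at all nearby interior points.\<close>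
    have "\<forall>\<^sub>F y in nhds t. (deriv ^^ j) f y = iter_deriv_on S j f y"
      using eventually_nhds_in_open[OF open_interior Suc.prems(2)]
      by eventually_elim (use Suc in auto)
    then have "deriv ((deriv ^^ j) f) t = deriv (iter_deriv_on S j f) t"
      by (rule deriv_cong_ev) simp
    also have "\<dots> = iter_deriv_on S (Suc j) f t"
      using D[of j t] Suc.prems by (intro DERIV_imp_deriv) auto
    finally show ?case by simp
  qed (simp add: iter_deriv_on_def)
qed

lemma isCont_iter_deriv_on:
  assumes Ck: "Ck_on S k f" and t: "t \<in> interior S" and "j \<le> k"
  shows "isCont (iter_deriv_on S j f) t"
proof (cases "j = k")
  case True
  then show ?thesis using Ck t by (auto simp: Ck_on_def intro: continuous_on_interior)
next
  case False
  then show ?thesis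
    using iter_deriv_on_interior(1)[OF Ck t, of j] assms by (auto intro: DERIV_isCont)
qed

text \<open>Taylor's formula of order \<open>q\<close> with Lagrange remainder: the terms of order
  \<open>1\<close> to \<open>q - 1\<close> vanish, and the remainder holds the \<open>q\<close>-th
  derivative at an intermediate point, which tends to its value at \<open>x\<close> by
  continuity.\<close>

lemma leading_taylor_coefficient:
  assumes Ck: "Ck_on S k f" and x: "x \<in> interior S" and q: "1 \<le> q" "q \<le> k"
    and vanish: "\<And>j. 1 \<le> j \<Longrightarrow> j < q \<Longrightarrow> (deriv ^^ j) f x = 0"
  shows "((\<lambda>t. (f t - f x) / (t - x) ^ q) \<longlongrightarrow> (deriv ^^ q) f x / fact q) (at x)"
proof -
  let ?d = "\<lambda>j. iter_deriv_on S j f"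
  obtain e where e: "0 < e" "cball x e \<subseteq> interior S"
    using open_contains_cball[of "interior S"] x by auto
  have rep: "\<exists>\<xi>. \<bar>\<xi> - x\<bar> < \<bar>t - x\<bar> \<and> (f t - f x) / (t - x) ^ q = ?d q \<xi> / fact q"
    if t: "t \<noteq> x" "\<bar>t - x\<bar> \<le> e" for t
  proof -
    have "\<exists>\<xi>. (if t < x then t < \<xi> \<and> \<xi> < x else x < \<xi> \<and> \<xi> < t) \<and>
        f t = (\<Sum>j<q. (?d j x / fact j) * (t - x) ^ j) + (?d q \<xi> / fact q) * (t - x) ^ q"
    proof (rule Taylor[where a="x - e" and b="x + e"])
      show "\<forall>m t. m < q \<and> x - e \<le> t \<and> t \<le> x + e \<longrightarrow> (?d m has_real_derivative ?d (Suc m) t) (at t)"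
        using e q by (auto simp: cball_eq_atLeastAtMost intro!: iter_deriv_on_interior(1)[OF Ck])
    qed (use t e q in \<open>auto simp: iter_deriv_on_def\<close>)
    then obtain \<xi> where \<xi>: "if t < x then t < \<xi> \<and> \<xi> < x else x < \<xi> \<and> \<xi> < t"
      and eq: "f t = (\<Sum>j<q. (?d j x / fact j) * (t - x) ^ j) + (?d q \<xi> / fact q) * (t - x) ^ q"
      by blast
    have "(\<Sum>j<q. (?d j x / fact j) * (t - x) ^ j) = (\<Sum>j<q. if j = 0 then f x else 0)"
    proof (intro sum.cong refl)
      fix j assume j: "j \<in> {..<q}"
      show "?d j x / fact j * (t - x) ^ j = (if j = 0 then f x else 0)"
      proof (cases "j = 0")
        case False
        then show ?thesis
          using j q vanish[of j] iter_deriv_on_interior(2)[OF Ck x, of j] by auto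
      qed (simp add: iter_deriv_on_def)
    qed
    also have "\<dots> = f x" using q by (simp add: sum.delta)
    finally have "f t - f x = ?d q \<xi> / fact q * (t - x) ^ q" using eq by simp
    then show ?thesis using \<xi> t by (intro exI[of _ \<xi>]) (auto split: if_splits)
  qed
  have dq: "(deriv ^^ q) f x = ?d q x"
    using iter_deriv_on_interior(2)[OF Ck x] q by simp
  show ?thesis
    unfolding dq
  proof (rule tendstoI)
    fix \<epsilon> :: real assume "\<epsilon> > 0"
    moreover have "isCont (\<lambda>t. ?d q t / fact q) x"
      using isCont_iter_deriv_on[OF Ck x q(2)] by (intro continuous_intros) auto
    ultimately obtain d where d: "d > 0"
      "\<And>\<xi>. \<bar>\<xi> - x\<bar> < d \<Longrightarrow> dist (?d q \<xi> / fact q) (?d q x / fact q) < \<epsilon>"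
      unfolding continuous_at_eps_delta dist_real_def by blast
    have "\<forall>\<^sub>F t in at x. t \<noteq> x \<and> \<bar>t - x\<bar> < min d e"
      unfolding eventually_at using d e by (intro exI[of _ "min d e"]) (auto simp: dist_real_def)
    then show "\<forall>\<^sub>F t in at x. dist ((f t - f x) / (t - x) ^ q) (?d q x / fact q) < \<epsilon>"
    proof eventually_elim
      case (elim t)
      then obtain \<xi> where "\<bar>\<xi> - x\<bar> < \<bar>t - x\<bar>" "(f t - f x) / (t - x) ^ q = ?d q \<xi> / fact q"
        using rep[of t] by auto
      then show ?case using d(2)[of \<xi>] elim by simp
    qed
  qed
qed

text \<open>To the right of \<open>x\<close> the quotient is nonnegative; for even \<open>q\<close>
  it would be nonpositive to the left, contradicting a nonzero common limit. It serves
  \<open>\<theta>\<^sub>0\<close> with exponent \<open>q\<close> and \<open>\<Phi>\<^sub>0\<close>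
  with exponent 1.\<close>

lemma mono_on_leading_coefficient:
  fixes f :: "real \<Rightarrow> real"
  assumes mono: "mono_on S f" and x: "x \<in> interior S"
    and lim: "((\<lambda>t. (f t - f x) / (t - x) ^ q) \<longlongrightarrow> L) (at x)" and L: "L \<noteq> 0"
  shows "0 < L" "odd q"
proof -
  have xS: "x \<in> S" using x interior_subset by blast
  have ev: "\<forall>\<^sub>F t in at x. t \<in> S"
    using x by (metis eventually_at_topological interior_subset open_interior subsetD)
  have right: "((\<lambda>t. (f t - f x) / (t - x) ^ q) \<longlongrightarrow> L) (at_right x)"
    and left: "((\<lambda>t. (f t - f x) / (t - x) ^ q) \<longlongrightarrow> L) (at_left x)"
    using lim by (auto simp: filterlim_at_split)
  have "\<forall>\<^sub>F t in at_right x. 0 \<le> (f t - f x) / (t - x) ^ q"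
    using ev unfolding eventually_at_filter
    by eventually_elim (use mono xS in \<open>auto simp: mono_on_def\<close>)
  then have "0 \<le> L"
    by (intro tendsto_lowerbound[OF right]) auto
  then show "0 < L" using L by simp
  show "odd q"
  proof
    assume q: "even q"
    have "\<forall>\<^sub>F t in at_left x. (f t - f x) / (t - x) ^ q \<le> 0"
      using ev unfolding eventually_at_filter
      by eventually_elim
        (use mono xS q in \<open>auto simp: mono_on_def divide_le_0_iff zero_le_even_power\<close>)
    then have "L \<le> 0"
      by (intro tendsto_upperbound[OF left]) auto
    then show False using \<open>0 < L\<close> by simp
  qed
qed

text \<open>Gathers the deterministic facts used later. By l'Hopital's rule the last quotient has
  the limit of \<open>(\<theta>\<^sub>0 t - \<theta>\<^sub>0 x) / (t - x) ^ q\<close> times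
  \<open>deriv \<Phi>\<^sub>0 x / (q + 1)\<close>.\<close>

lemma assumption_A_expansion:
  assumes x: "x \<in> interior I"
    and nz: "\<exists>j\<ge>1. (deriv ^^ j) \<theta>\<^sub>0 x \<noteq> 0"
    and q_def: "q = (LEAST j. j \<ge> 1 \<and> (deriv ^^ j) \<theta>\<^sub>0 x \<noteq> 0)"
    and A: "assumption_A q I \<theta>\<^sub>0 \<Phi>\<^sub>0 x"
  shows "1 \<le> q" "odd q" "0 < Dq q \<theta>\<^sub>0 \<Phi>\<^sub>0 x" "\<Phi>\<^sub>0 differentiable at x"
    and "((\<lambda>\<eta>. (Gamma0 I \<theta>\<^sub>0 \<Phi>\<^sub>0 (x + \<eta>) - Gamma0 I \<theta>\<^sub>0 \<Phi>\<^sub>0 x - \<theta>\<^sub>0 x * (\<Phi>\<^sub>0 (x + \<eta>) - \<Phi>\<^sub>0 x)) /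
            \<eta> ^ (q + 1)) \<longlongrightarrow> Dq q \<theta>\<^sub>0 \<Phi>\<^sub>0 x) (at_right 0)"
proof -
  obtain \<delta> s where \<delta>: "\<delta> > 0" and s: "s \<ge> real q"
    and AA: "let S = cball x \<delta>; m = nat \<lfloor>s\<rfloor>; \<alpha> = s - real m in
        is_interval I \<and> S \<subseteq> I \<and>
        mono_on I \<theta>\<^sub>0 \<and> bounded (\<theta>\<^sub>0 ` I) \<and>
        Ck_on S m \<theta>\<^sub>0 \<and> holder_on S \<alpha> (iter_deriv_on S m \<theta>\<^sub>0) \<and>
        (\<forall>t\<in>I. 0 \<le> \<Phi>\<^sub>0 t) \<and> mono_on I \<Phi>\<^sub>0 \<and> continuous_on I \<Phi>\<^sub>0 \<and> bounded (\<Phi>\<^sub>0 ` I) \<and>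
        Ck_on S (m - q + 1) \<Phi>\<^sub>0 \<and> deriv \<Phi>\<^sub>0 x \<noteq> 0 \<and>
        holder_on S \<alpha> (iter_deriv_on S (m - q + 1) \<Phi>\<^sub>0)"
    using A unfolding assumption_A_def by blast
  define S where "S = cball x \<delta>"
  define m where "m = nat \<lfloor>s\<rfloor>"
  have I: "is_interval I" and SI: "S \<subseteq> I" and mono: "mono_on I \<theta>\<^sub>0" "mono_on I \<Phi>\<^sub>0"
    and bdd: "bounded (\<theta>\<^sub>0 ` I)" and nonneg: "\<And>t. t \<in> I \<Longrightarrow> 0 \<le> \<Phi>\<^sub>0 t"
    and Ck: "Ck_on S m \<theta>\<^sub>0" "Ck_on S (m - q + 1) \<Phi>\<^sub>0" and dPhi: "deriv \<Phi>\<^sub>0 x \<noteq> 0"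
    using AA unfolding S_def m_def Let_def by blast+
  \<comment> \<open>As \<open>q\<close> is an integer, \<open>s \<ge> q\<close> survives rounding
    down, so \<open>\<theta>\<^sub>0\<close> has enough derivatives for the expansion.\<close>
  have qm: "q \<le> m" using s unfolding m_def by (simp add: le_nat_iff le_floor_iff)
  have xS: "x \<in> interior S" using \<delta> by (simp add: S_def interior_cball)
  have q1: "1 \<le> q" and dq: "(deriv ^^ q) \<theta>\<^sub>0 x \<noteq> 0"
    using LeastI_ex[OF nz] unfolding q_def by auto
  have vanish: "(deriv ^^ j) \<theta>\<^sub>0 x = 0" if "1 \<le> j" "j < q" for j
    using not_less_Least[of j "\<lambda>j. j \<ge> 1 \<and> (deriv ^^ j) \<theta>\<^sub>0 x \<noteq> 0"] that unfolding q_def by auto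
  have lim_theta: "((\<lambda>t. (\<theta>\<^sub>0 t - \<theta>\<^sub>0 x) / (t - x) ^ q) \<longlongrightarrow> (deriv ^^ q) \<theta>\<^sub>0 x / fact q) (at x)"
    by (rule leading_taylor_coefficient[OF Ck(1) xS q1 qm vanish])
  \<comment> \<open>The smoothness order \<open>m - q + 1\<close> is at least 1, so
    \<open>\<Phi>\<^sub>0\<close> has a derivative near \<open>x\<close> that is continuous
    there.\<close>
  define P where "P = iter_deriv_on S 1 \<Phi>\<^sub>0"
  have P: "(\<Phi>\<^sub>0 has_real_derivative P t) (at t)" if "t \<in> interior S" for t
    using iter_deriv_on_interior(1)[OF Ck(2) that, of 0] by (simp add: P_def iter_deriv_on_def)
  have Px: "deriv \<Phi>\<^sub>0 x = P x" using P[OF xS] by (rule DERIV_imp_deriv)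
  have contP: "isCont P x"
    unfolding P_def by (rule isCont_iter_deriv_on[OF Ck(2) xS]) simp
  have "((\<lambda>t. (\<Phi>\<^sub>0 t - \<Phi>\<^sub>0 x) / (t - x) ^ 1) \<longlongrightarrow> deriv \<Phi>\<^sub>0 x) (at x)"
    using P[OF xS] Px by (simp add: has_field_derivative_iff)
  from mono_on_leading_coefficient(1)[OF mono(2) x this dPhi] have "0 < deriv \<Phi>\<^sub>0 x" .
  moreover have "0 < (deriv ^^ q) \<theta>\<^sub>0 x / fact q" and "odd q"
    using mono_on_leading_coefficient[OF mono(1) x lim_theta] dq by auto
  ultimately show "1 \<le> q" "odd q" "0 < Dq q \<theta>\<^sub>0 \<Phi>\<^sub>0 x"
    using q1 by (simp_all add: Dq_def zero_less_divide_iff del: fact_Suc)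
  show "\<Phi>\<^sub>0 differentiable at x"
    using P[OF xS] by (auto simp: real_differentiable_def)
  let ?\<Gamma> = "Gamma0 I \<theta>\<^sub>0 \<Phi>\<^sub>0"
  let ?H = "\<lambda>t. ?\<Gamma> t - ?\<Gamma> x - \<theta>\<^sub>0 x * (\<Phi>\<^sub>0 t - \<Phi>\<^sub>0 x)"
  have contT: "isCont \<theta>\<^sub>0 t" if "t \<in> interior S" for t
    using isCont_iter_deriv_on[OF Ck(1) that, of 0] by (simp add: iter_deriv_on_def)
  have dH: "(?H has_real_derivative (\<theta>\<^sub>0 t - \<theta>\<^sub>0 x) * P t) (at t)" if t: "t \<in> interior S" for t
  proof -
    have "t \<in> interior I" using t SI interior_mono by blast
    then have "(?\<Gamma> has_real_derivative \<theta>\<^sub>0 t * P t) (at t)"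
      by (intro Gamma0_has_real_derivative[OF I mono(1) bdd nonneg mono(2)] contT P t)
    then show ?thesis
      by (auto intro!: derivative_eq_intros P[OF t] simp: algebra_simps)
  qed
  have evS: "\<forall>\<^sub>F t in at_right x. t \<in> interior S"
    using xS eventually_at_topological open_interior by blast
  have "((\<lambda>t. ?H t / (t - x) ^ (q + 1)) \<longlongrightarrow> Dq q \<theta>\<^sub>0 \<Phi>\<^sub>0 x) (at_right x)"
  proof (rule lhopital_right)
    have "(?H \<longlongrightarrow> ?H x) (at_right x)"
      using DERIV_isCont[OF dH[OF xS]] by (simp add: isCont_def filterlim_at_split)
    then show "(?H \<longlongrightarrow> 0) (at_right x)" by simp
    have "((\<lambda>t. (t - x) ^ (q + 1)) \<longlongrightarrow> (x - x) ^ (q + 1)) (at_right x)"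
      by (intro tendsto_intros)
    then show "((\<lambda>t. (t - x) ^ (q + 1)) \<longlongrightarrow> 0) (at_right x)" by simp
    show "\<forall>\<^sub>F t in at_right x. (t - x) ^ (q + 1) \<noteq> 0"
      unfolding eventually_at_filter by simp
    show "\<forall>\<^sub>F t in at_right x. real (q + 1) * (t - x) ^ q \<noteq> 0"
      unfolding eventually_at_filter by simp
    show "\<forall>\<^sub>F t in at_right x. (?H has_real_derivative (\<theta>\<^sub>0 t - \<theta>\<^sub>0 x) * P t) (at t)"
      using evS by eventually_elim (rule dH)
    show "\<forall>\<^sub>F t in at_right x. ((\<lambda>t. (t - x) ^ (q + 1)) has_real_derivative real (q + 1) * (t - x) ^ q) (at t)"
    proof (intro always_eventually allI)
      fix t
      have "((\<lambda>t. t - x) has_real_derivative 1) (at t)"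
        by (auto intro!: derivative_eq_intros)
      from DERIV_power_Suc[OF this, of q]
      show "((\<lambda>t. (t - x) ^ (q + 1)) has_real_derivative real (q + 1) * (t - x) ^ q) (at t)"
        by simp
    qed
    have "((\<lambda>t. (\<theta>\<^sub>0 t - \<theta>\<^sub>0 x) / (t - x) ^ q * P t / real (q + 1)) \<longlongrightarrow>
        (deriv ^^ q) \<theta>\<^sub>0 x / fact q * P x / real (q + 1)) (at x)"
      using contP unfolding isCont_def by (intro tendsto_divide tendsto_mult lim_theta tendsto_const) auto
    \<comment> \<open>Here \<open>fact q\<close> and the factor \<open>q + 1\<close> from
      differentiating the denominator combine to \<open>fact (q + 1)\<close>.\<close>
    moreover have "(deriv ^^ q) \<theta>\<^sub>0 x / fact q * P x / real (q + 1) = Dq q \<theta>\<^sub>0 \<Phi>\<^sub>0 x"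
      by (simp add: Dq_def Px mult_ac)
    ultimately show "((\<lambda>t. (\<theta>\<^sub>0 t - \<theta>\<^sub>0 x) * P t / (real (q + 1) * (t - x) ^ q)) \<longlongrightarrow> Dq q \<theta>\<^sub>0 \<Phi>\<^sub>0 x) (at_right x)"
      by (simp add: filterlim_at_split mult_ac)
  qed
  then show "((\<lambda>\<eta>. ?H (x + \<eta>) / \<eta> ^ (q + 1)) \<longlongrightarrow> Dq q \<theta>\<^sub>0 \<Phi>\<^sub>0 x) (at_right 0)"
    unfolding filterlim_at_right_to_0[of _ _ x] by (simp add: add.commute)
qed

section \<open>Stochastic order and convergence in probability\<close>

lemma tendsto_in_probD:
  "tendsto_in_prob M X l \<Longrightarrow> 0 < e \<Longrightarrow> (\<lambda>n. measure M {\<omega> \<in> space M. \<bar>X n \<omega> - l\<bar> > e}) \<longlonglongrightarrow> 0"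
  by (simp add: tendsto_in_prob_def)

context finite_measure
begin

text \<open>Thresholds may be enlarged, and a positive one can later serve as a factor or divisor.
  Measurability is asked only eventually because \<open>x + \<eta> n\<close> is known to lie in
  \<open>I\<close> only for large \<open>n\<close>.\<close>

lemma bounded_in_prob_tail:
  assumes "bounded_in_prob M X" "0 < e" "\<forall>\<^sub>F n in sequentially. X n \<in> borel_measurable M"
  obtains K where "0 < K" "\<forall>\<^sub>F n in sequentially. measure M {\<omega> \<in> space M. \<bar>X n \<omega>\<bar> > K} \<le> e"
proof -
  obtain K where K: "\<forall>\<^sub>F n in sequentially. measure M {\<omega> \<in> space M. \<bar>X n \<omega>\<bar> > K} \<le> e"
    using assms(1,2) unfolding bounded_in_prob_def by blast
  have "\<forall>\<^sub>F n in sequentially. measure M {\<omega> \<in> space M. \<bar>X n \<omega>\<bar> > max K 1} \<le> e"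
    using K assms(3)
  proof eventually_elim
    case (elim n)
    note [measurable] = elim(2)
    have "measure M {\<omega> \<in> space M. \<bar>X n \<omega>\<bar> > max K 1} \<le> measure M {\<omega> \<in> space M. \<bar>X n \<omega>\<bar> > K}"
      by (intro finite_measure_mono) auto
    then show ?case using elim(1) by simp
  qed
  then show thesis by (intro that[of "max K 1"]) auto
qed

text \<open>A product exceeding \<open>K * L\<close> forces one factor beyond its own threshold; the
  two tails are then added.\<close>

lemma bounded_in_prob_mult:
  assumes X: "bounded_in_prob M X" and mX: "\<forall>\<^sub>F n in sequentially. X n \<in> borel_measurable M"
    and Y: "bounded_in_prob M Y" and mY: "\<forall>\<^sub>F n in sequentially. Y n \<in> borel_measurable M"
  shows "bounded_in_prob M (\<lambda>n \<omega>. X n \<omega> * Y n \<omega>)"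
  unfolding bounded_in_prob_def
proof safe
  fix e :: real assume "e > 0"
  then have e2: "e / 2 > 0" by simp
  obtain K where K: "0 < K" "\<forall>\<^sub>F n in sequentially. measure M {\<omega> \<in> space M. \<bar>X n \<omega>\<bar> > K} \<le> e / 2"
    using bounded_in_prob_tail[OF X e2 mX] .
  obtain L where L: "0 < L" "\<forall>\<^sub>F n in sequentially. measure M {\<omega> \<in> space M. \<bar>Y n \<omega>\<bar> > L} \<le> e / 2"
    using bounded_in_prob_tail[OF Y e2 mY] .
  have "\<forall>\<^sub>F n in sequentially. measure M {\<omega> \<in> space M. \<bar>X n \<omega> * Y n \<omega>\<bar> > K * L} \<le> e"
    using K(2) L(2) mX mY
  proof eventually_elim
    case (elim n)
    note [measurable] = elim(3,4)
    have "measure M {\<omega> \<in> space M. \<bar>X n \<omega> * Y n \<omega>\<bar> > K * L} \<le>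
        measure M ({\<omega> \<in> space M. \<bar>X n \<omega>\<bar> > K} \<union> {\<omega> \<in> space M. \<bar>Y n \<omega>\<bar> > L})"
    proof (rule finite_measure_mono)
      show "{\<omega> \<in> space M. \<bar>X n \<omega> * Y n \<omega>\<bar> > K * L} \<subseteq>
          {\<omega> \<in> space M. \<bar>X n \<omega>\<bar> > K} \<union> {\<omega> \<in> space M. \<bar>Y n \<omega>\<bar> > L}"
        using K(1) by (auto simp: abs_mult not_less) (metis abs_ge_zero less_imp_le mult_mono not_less)
    qed measurable
    also have "\<dots> \<le> measure M {\<omega> \<in> space M. \<bar>X n \<omega>\<bar> > K} + measure M {\<omega> \<in> space M. \<bar>Y n \<omega>\<bar> > L}"
      by (intro measure_subadditive) (auto simp: emeasure_eq_measure)
    finally show ?case using elim(1,2) by simp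
  qed
  then show "\<exists>K. \<forall>\<^sub>F n in sequentially. measure M {\<omega> \<in> space M. \<bar>X n \<omega> * Y n \<omega>\<bar> > K} \<le> e"
    by blast
qed

lemma bounded_in_prob_add_Bseq:
  assumes X: "bounded_in_prob M X" and mX: "\<forall>\<^sub>F n in sequentially. X n \<in> borel_measurable M"
    and d: "Bseq d"
  shows "bounded_in_prob M (\<lambda>n \<omega>. X n \<omega> + d n)"
  unfolding bounded_in_prob_def
proof safe
  fix e :: real assume e: "e > 0"
  obtain K where K: "0 < K" "\<forall>\<^sub>F n in sequentially. measure M {\<omega> \<in> space M. \<bar>X n \<omega>\<bar> > K} \<le> e"
    using bounded_in_prob_tail[OF X e mX] .
  obtain B where B: "\<And>n. \<bar>d n\<bar> \<le> B"
    using d unfolding Bseq_def by auto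
  have "\<forall>\<^sub>F n in sequentially. measure M {\<omega> \<in> space M. \<bar>X n \<omega> + d n\<bar> > K + B} \<le> e"
    using K(2) mX
  proof eventually_elim
    case (elim n)
    note [measurable] = elim(2)
    have "measure M {\<omega> \<in> space M. \<bar>X n \<omega> + d n\<bar> > K + B} \<le> measure M {\<omega> \<in> space M. \<bar>X n \<omega>\<bar> > K}"
    proof (rule finite_measure_mono)
      show "{\<omega> \<in> space M. \<bar>X n \<omega> + d n\<bar> > K + B} \<subseteq> {\<omega> \<in> space M. \<bar>X n \<omega>\<bar> > K}"
        using B[of n] by auto
    qed measurable
    then show ?case using elim(1) by simp
  qed
  then show "\<exists>K. \<forall>\<^sub>F n in sequentially. measure M {\<omega> \<in> space M. \<bar>X n \<omega> + d n\<bar> > K} \<le> e"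
    by blast
qed

text \<open>Once \<open>\<bar>c n\<bar> < e / K\<close>, the product can exceed \<open>e\<close>
  only where \<open>\<bar>X n \<omega>\<bar> > K\<close>.\<close>

lemma bounded_in_prob_mult_null:
  assumes X: "bounded_in_prob M X" and mX: "\<forall>\<^sub>F n in sequentially. X n \<in> borel_measurable M"
    and c: "c \<longlonglongrightarrow> 0"
  shows "tendsto_in_prob M (\<lambda>n \<omega>. X n \<omega> * c n) 0"
  unfolding tendsto_in_prob_def
proof safe
  fix e :: real assume e: "e > 0"
  show "(\<lambda>n. measure M {\<omega> \<in> space M. \<bar>X n \<omega> * c n - 0\<bar> > e}) \<longlonglongrightarrow> 0"
  proof (rule tendstoI)
    fix r :: real assume "r > 0"
    then have r2: "r / 2 > 0" by simp
    obtain K where K: "0 < K" "\<forall>\<^sub>F n in sequentially. measure M {\<omega> \<in> space M. \<bar>X n \<omega>\<bar> > K} \<le> r / 2"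
      using bounded_in_prob_tail[OF X r2 mX] .
    have "\<forall>\<^sub>F n in sequentially. \<bar>c n\<bar> < e / K"
      using tendstoD[OF c, of "e / K"] e K(1) by (simp add: dist_real_def)
    then show "\<forall>\<^sub>F n in sequentially. dist (measure M {\<omega> \<in> space M. \<bar>X n \<omega> * c n - 0\<bar> > e}) 0 < r"
      using K(2) mX
    proof eventually_elim
      case (elim n)
      note [measurable] = elim(3)
      have "measure M {\<omega> \<in> space M. \<bar>X n \<omega> * c n - 0\<bar> > e} \<le> measure M {\<omega> \<in> space M. \<bar>X n \<omega>\<bar> > K}"
      proof (rule finite_measure_mono)
        show "{\<omega> \<in> space M. \<bar>X n \<omega> * c n - 0\<bar> > e} \<subseteq> {\<omega> \<in> space M. \<bar>X n \<omega>\<bar> > K}"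
        proof safe
          fix \<omega> assume *: "\<bar>X n \<omega> * c n - 0\<bar> > e"
          show "\<bar>X n \<omega>\<bar> > K"
          proof (rule ccontr)
            assume "\<not> \<bar>X n \<omega>\<bar> > K"
            then have "\<bar>X n \<omega>\<bar> * \<bar>c n\<bar> \<le> K * (e / K)"
              using elim(1) K(1) by (intro mult_mono) auto
            then show False using * K(1) by (simp add: abs_mult)
          qed
        qed
      qed measurable
      then show ?case using elim(2) \<open>r > 0\<close> by (simp add: dist_real_def)
    qed
  qed
qed

text \<open>Tail events of \<open>Y\<close> lie inside tail events of \<open>X\<close>.
  Measurability is required of \<open>X\<close> alone, so \<open>Y\<close> may be a supremum over an
  uncountable compact set.\<close>

lemma tendsto_in_prob_dominated:
  assumes X: "tendsto_in_prob M X l" and mX: "\<forall>\<^sub>F n in sequentially. X n \<in> borel_measurable M"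
    and le: "\<forall>\<^sub>F n in sequentially. \<forall>\<omega>\<in>space M. \<bar>Y n \<omega> - m\<bar> \<le> C * \<bar>X n \<omega> - l\<bar>"
  shows "tendsto_in_prob M Y m"
  unfolding tendsto_in_prob_def
proof safe
  fix e :: real assume e: "e > 0"
  \<comment> \<open>Enlarging \<open>C\<close> to a positive constant permits division by
    it.\<close>
  define C' where "C' = max C 1"
  have C': "C \<le> C'" "0 < C'" by (auto simp: C'_def)
  have lim: "(\<lambda>n. measure M {\<omega> \<in> space M. \<bar>X n \<omega> - l\<bar> > e / C'}) \<longlonglongrightarrow> 0"
    using X e C' by (simp add: tendsto_in_prob_def)
  have "\<forall>\<^sub>F n in sequentially. measure M {\<omega> \<in> space M. \<bar>Y n \<omega> - m\<bar> > e} \<le>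
      measure M {\<omega> \<in> space M. \<bar>X n \<omega> - l\<bar> > e / C'}"
    using mX le
  proof eventually_elim
    case (elim n)
    note [measurable] = elim(1)
    show ?case
    proof (rule finite_measure_mono)
      show "{\<omega> \<in> space M. \<bar>Y n \<omega> - m\<bar> > e} \<subseteq> {\<omega> \<in> space M. \<bar>X n \<omega> - l\<bar> > e / C'}"
      proof safe
        fix \<omega> assume \<omega>: "\<omega> \<in> space M" "\<bar>Y n \<omega> - m\<bar> > e"
        have "e < C * \<bar>X n \<omega> - l\<bar>" using elim(2) \<omega> by force
        also have "\<dots> \<le> C' * \<bar>X n \<omega> - l\<bar>" using C' by (intro mult_right_mono) auto
        finally show "\<bar>X n \<omega> - l\<bar> > e / C'" using C' by (simp add: divide_less_eq mult.commute)
      qed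
    qed measurable
  qed
  then show "(\<lambda>n. measure M {\<omega> \<in> space M. \<bar>Y n \<omega> - m\<bar> > e}) \<longlonglongrightarrow> 0"
    by (rule tendsto_sandwich[OF _ _ tendsto_const lim, rotated]) simp
qed

lemma tendsto_in_prob_add:
  assumes X: "tendsto_in_prob M X a" and mX: "\<forall>\<^sub>F n in sequentially. X n \<in> borel_measurable M"
    and Y: "tendsto_in_prob M Y b" and mY: "\<forall>\<^sub>F n in sequentially. Y n \<in> borel_measurable M"
  shows "tendsto_in_prob M (\<lambda>n \<omega>. X n \<omega> + Y n \<omega>) (a + b)"
  unfolding tendsto_in_prob_def
proof safe
  fix e :: real assume e: "e > 0"
  have lim: "(\<lambda>n. measure M {\<omega> \<in> space M. \<bar>X n \<omega> - a\<bar> > e / 2} + measure M {\<omega> \<in> space M. \<bar>Y n \<omega> - b\<bar> > e / 2})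
      \<longlonglongrightarrow> 0 + 0"
    using e by (intro tendsto_add tendsto_in_probD[OF X] tendsto_in_probD[OF Y]) auto
  have "\<forall>\<^sub>F n in sequentially. measure M {\<omega> \<in> space M. \<bar>X n \<omega> + Y n \<omega> - (a + b)\<bar> > e} \<le>
      measure M {\<omega> \<in> space M. \<bar>X n \<omega> - a\<bar> > e / 2} + measure M {\<omega> \<in> space M. \<bar>Y n \<omega> - b\<bar> > e / 2}"
    using mX mY
  proof eventually_elim
    case (elim n)
    note [measurable] = elim
    have "measure M {\<omega> \<in> space M. \<bar>X n \<omega> + Y n \<omega> - (a + b)\<bar> > e} \<le>
        measure M ({\<omega> \<in> space M. \<bar>X n \<omega> - a\<bar> > e / 2} \<union> {\<omega> \<in> space M. \<bar>Y n \<omega> - b\<bar> > e / 2})"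
    proof (rule finite_measure_mono)
      show "{\<omega> \<in> space M. \<bar>X n \<omega> + Y n \<omega> - (a + b)\<bar> > e} \<subseteq>
          {\<omega> \<in> space M. \<bar>X n \<omega> - a\<bar> > e / 2} \<union> {\<omega> \<in> space M. \<bar>Y n \<omega> - b\<bar> > e / 2}"
        by (auto simp: abs_if split: if_splits)
    qed measurable
    also have "\<dots> \<le> measure M {\<omega> \<in> space M. \<bar>X n \<omega> - a\<bar> > e / 2} +
        measure M {\<omega> \<in> space M. \<bar>Y n \<omega> - b\<bar> > e / 2}"
      by (intro measure_subadditive) (auto simp: emeasure_eq_measure)
    finally show ?case .
  qed
  then show "(\<lambda>n. measure M {\<omega> \<in> space M. \<bar>X n \<omega> + Y n \<omega> - (a + b)\<bar> > e}) \<longlonglongrightarrow> 0"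
    by (rule tendsto_sandwich[OF _ _ tendsto_const lim[unfolded add_0], rotated]) simp
qed

lemma tendsto_in_prob_sum:
  assumes "finite A"
    and "\<And>k. k \<in> A \<Longrightarrow> tendsto_in_prob M (X k) (l k)"
    and "\<And>k. k \<in> A \<Longrightarrow> \<forall>\<^sub>F n in sequentially. X k n \<in> borel_measurable M"
  shows "tendsto_in_prob M (\<lambda>n \<omega>. \<Sum>k\<in>A. X k n \<omega>) (\<Sum>k\<in>A. l k)"
  using assms
proof (induction A rule: finite_induct)
  case empty
  then show ?case by (simp add: tendsto_in_prob_def)
next
  case (insert a A)
  have "\<forall>\<^sub>F n in sequentially. \<forall>k\<in>A. X k n \<in> borel_measurable M"
    using insert by (intro eventually_ball_finite) auto
  then have "\<forall>\<^sub>F n in sequentially. (\<lambda>\<omega>. \<Sum>k\<in>A. X k n \<omega>) \<in> borel_measurable M"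
    by eventually_elim (auto intro: borel_measurable_sum)
  then show ?case
    using insert by (simp add: tendsto_in_prob_add)
qed

lemma tendsto_in_prob_of_tendsto:
  assumes "d \<longlonglongrightarrow> l"
  shows "tendsto_in_prob M (\<lambda>n _. d n) l"
  unfolding tendsto_in_prob_def
proof safe
  fix e :: real assume "e > 0"
  have "\<forall>\<^sub>F n in sequentially. measure M {\<omega> \<in> space M. \<bar>d n - l\<bar> > e} = 0"
    using tendstoD[OF assms \<open>e > 0\<close>] by eventually_elim (simp add: dist_real_def)
  then show "(\<lambda>n. measure M {\<omega> \<in> space M. \<bar>d n - l\<bar> > e}) \<longlonglongrightarrow> 0"
    by (rule tendsto_eventually)
qed

text \<open>All randomness sits in the scalar \<open>D\<close>: on a compact set the deviation is at
  most \<open>\<bar>D n \<omega> - d\<bar>\<close> times a bound for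
  \<open>\<bar>f\<bar>\<close>.\<close>

lemma tendsto_in_prob_compacta_scaled:
  assumes D: "tendsto_in_prob M D d" and mD: "\<forall>\<^sub>F n in sequentially. D n \<in> borel_measurable M"
    and X: "\<forall>\<^sub>F n in sequentially. \<forall>\<omega>\<in>space M. \<forall>v. X n \<omega> v = D n \<omega> * f v"
    and f: "continuous_on UNIV f"
  shows "tendsto_in_prob_compacta M X (\<lambda>v. d * f v)"
  unfolding tendsto_in_prob_compacta_def
proof (intro allI impI)
  fix C :: "real set" assume "compact C \<and> C \<noteq> {}"
  then have C: "compact C" "C \<noteq> {}" by auto
  have "compact (f ` C)"
    using C(1) f by (metis compact_continuous_image continuous_on_subset top_greatest)
  then obtain B where B: "\<And>v. v \<in> C \<Longrightarrow> \<bar>f v\<bar> \<le> B"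
    using compact_imp_bounded[of "f ` C"] unfolding bounded_iff by auto
  show "tendsto_in_prob M (\<lambda>n \<omega>. SUP v\<in>C. \<bar>X n \<omega> v - d * f v\<bar>) 0"
  proof (rule tendsto_in_prob_dominated[OF D mD])
    show "\<forall>\<^sub>F n in sequentially. \<forall>\<omega>\<in>space M. \<bar>(SUP v\<in>C. \<bar>X n \<omega> v - d * f v\<bar>) - 0\<bar> \<le> B * \<bar>D n \<omega> - d\<bar>"
      using X
    proof eventually_elim
      case (elim n)
      have "\<bar>\<bar>X n \<omega> v - d * f v\<bar>\<bar> \<le> B * \<bar>D n \<omega> - d\<bar>" if "\<omega> \<in> space M" "v \<in> C" for \<omega> v
      proof -
        have "\<bar>X n \<omega> v - d * f v\<bar> = \<bar>f v\<bar> * \<bar>D n \<omega> - d\<bar>"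
          using elim that by (simp add: algebra_simps flip: abs_mult)
        then show ?thesis using B[OF that(2)] by (simp add: mult_right_mono)
      qed
      then show ?case using C(2) by (auto intro!: cSup_abs_le)
    qed
  qed
qed

end

section \<open>Lower bounds away from the origin\<close>

text \<open>An equivalence allows the event about the infimum to be rewritten as the event
  \<open>c \<le> D n \<omega>\<close>. Evenness of \<open>p\<close> handles negative
  \<open>v\<close>; the \<open>ereal\<close> infimum also makes sense for negative \<open>d\<close>,
  where the values can be unbounded below.\<close>

lemma le_INF_even_power_iff:
  assumes "even p" "0 < c" "0 < K"
  shows "(INF v\<in>{v. \<bar>v\<bar> > inverse K}. ereal (d * v ^ p)) \<ge> ereal (c * inverse (K ^ p)) \<longleftrightarrow> c \<le> d"
proof
  assume "(INF v\<in>{v. \<bar>v\<bar> > inverse K}. ereal (d * v ^ p)) \<ge> ereal (c * inverse (K ^ p))"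
  then have le: "c * inverse (K ^ p) \<le> d * v ^ p" if "inverse K < v" for v
    using that by (auto simp: le_INF_iff)
  \<comment> \<open>The point \<open>inverse K\<close> is excluded from the infimum, so its value is
    reached as a limit from the right.\<close>
  have "((\<lambda>v. d * v ^ p) \<longlongrightarrow> d * inverse K ^ p) (at_right (inverse K))"
    by (intro tendsto_intros)
  moreover have "\<forall>\<^sub>F v in at_right (inverse K). c * inverse (K ^ p) \<le> d * v ^ p"
    using eventually_at_right_less by eventually_elim (rule le)
  ultimately have "c * inverse (K ^ p) \<le> d * inverse K ^ p"
    by (intro tendsto_lowerbound) auto
  then show "c \<le> d" using assms by (simp add: power_inverse)
next
  assume "c \<le> d"
  have "c * inverse (K ^ p) \<le> d * v ^ p" if "inverse K < \<bar>v\<bar>" for v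
  proof -
    have "inverse (K ^ p) \<le> \<bar>v\<bar> ^ p"
      using that assms by (simp add: power_mono flip: power_inverse)
    then show ?thesis
      using \<open>c \<le> d\<close> assms by (intro mult_mono) (auto simp: power_even_abs)
  qed
  then show "(INF v\<in>{v. \<bar>v\<bar> > inverse K}. ereal (d * v ^ p)) \<ge> ereal (c * inverse (K ^ p))"
    by (auto simp: le_INF_iff)
qed

text \<open>Within distance \<open>(d - c) / 2\<close> of \<open>d\<close> the variable is above
  \<open>c\<close>, and this neighbourhood has probability tending to one.\<close>

lemma (in prob_space) tendsto_in_prob_liminf_ge:
  assumes D: "tendsto_in_prob M D d" and mD: "\<forall>\<^sub>F n in sequentially. D n \<in> borel_measurable M"
    and c: "c < d"
  shows "liminf (\<lambda>n. ereal (measure M {\<omega> \<in> space M. c \<le> D n \<omega>})) = 1"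
proof -
  let ?p = "\<lambda>n. measure M {\<omega> \<in> space M. \<bar>D n \<omega> - d\<bar> > (d - c) / 2}"
  have lower: "(\<lambda>n. 1 - ?p n) \<longlonglongrightarrow> 1 - 0"
    using c by (intro tendsto_intros tendsto_in_probD[OF D]) auto
  have "\<forall>\<^sub>F n in sequentially. 1 - ?p n \<le> measure M {\<omega> \<in> space M. c \<le> D n \<omega>}"
    using mD
  proof eventually_elim
    case (elim n)
    note [measurable] = elim
    have "1 - ?p n = measure M (space M - {\<omega> \<in> space M. \<bar>D n \<omega> - d\<bar> > (d - c) / 2})"
      by (subst prob_compl) auto
    also have "\<dots> \<le> measure M {\<omega> \<in> space M. c \<le> D n \<omega>}"
    proof (rule finite_measure_mono)
      show "space M - {\<omega> \<in> space M. \<bar>D n \<omega> - d\<bar> > (d - c) / 2} \<subseteq> {\<omega> \<in> space M. c \<le> D n \<omega>}"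
        using c by (auto simp: abs_if field_simps split: if_splits)
    qed measurable
    finally show ?case .
  qed
  then have "(\<lambda>n. measure M {\<omega> \<in> space M. c \<le> D n \<omega>}) \<longlonglongrightarrow> 1"
    by (rule tendsto_sandwich[OF _ _ lower[unfolded diff_zero] tendsto_const]) simp
  then have "(\<lambda>n. ereal (measure M {\<omega> \<in> space M. c \<le> D n \<omega>})) \<longlonglongrightarrow> ereal 1"
    by simp
  then show ?thesis
    unfolding one_ereal_def by (rule lim_imp_Liminf[OF sequentially_bot])
qed

section \<open>Consistency of the estimators\<close>

text \<open>Every normalization becomes a power of the single quantity
  \<open>n * \<eta> ^ (1 + 2 * q)\<close>, which the bandwidth condition sends to infinity.\<close>

lemma rate_times_bandwidth:
  assumes "0 < \<eta>" "1 \<le> n"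
  shows "sqrt (real n / \<eta>) * \<eta> ^ (q + 1) = sqrt (real n * \<eta> ^ (1 + 2 * q))"
    and "r_rate q n * \<eta> ^ q = (real n * \<eta> ^ (1 + 2 * q)) powr (real q / (1 + 2 * real q))"
    and "a_rate q n * \<eta> = (real n * \<eta> ^ (1 + 2 * q)) powr (1 / (1 + 2 * real q))"
proof -
  have "real n * \<eta> ^ (1 + 2 * q) = real n / \<eta> * (\<eta> ^ (q + 1))\<^sup>2"
    using assms by (simp add: field_simps power2_eq_square power_add mult_2 mult_2_right)
  then show "sqrt (real n / \<eta>) * \<eta> ^ (q + 1) = sqrt (real n * \<eta> ^ (1 + 2 * q))"
    using assms by (simp only: real_sqrt_mult real_sqrt_abs) simp
  have "(real n * \<eta> ^ (1 + 2 * q)) powr (c / (1 + 2 * real q)) =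
      real n powr (c / (1 + 2 * real q)) * \<eta> powr c" for c
  proof -
    have "\<eta> ^ (1 + 2 * q) = \<eta> powr (1 + 2 * real q)"
      using assms powr_realpow[of \<eta> "1 + 2 * q"] by simp
    then show ?thesis using assms by (simp add: powr_mult powr_powr add_eq_0_iff)
  qed
  from this[of "real q"] this[of 1]
  show "r_rate q n * \<eta> ^ q = (real n * \<eta> ^ (1 + 2 * q)) powr (real q / (1 + 2 * real q))"
    and "a_rate q n * \<eta> = (real n * \<eta> ^ (1 + 2 * q)) powr (1 / (1 + 2 * real q))"
    using assms by (simp_all add: r_rate_def a_rate_def powr_realpow)
qed

text \<open>From \<open>a_rate q n ^ (1 + 2 * q) = n\<close> it follows that
  \<open>n * a_rate q n\<close> is the square of \<open>a_rate q n ^ (q + 1)\<close>, so the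
  rescaling cancels exactly and not only in the limit.\<close>

lemma sqrt_rate_scaling:
  assumes "1 \<le> n"
  shows "sqrt (real n * a_rate q n) * (d * (v * inverse (a_rate q n)) ^ (q + 1)) = d * v ^ (q + 1)"
proof -
  have a: "0 < a_rate q n" using assms by (simp add: a_rate_def)
  have "a_rate q n ^ (1 + 2 * q) = a_rate q n powr (1 + 2 * real q)"
    using a powr_realpow[of "a_rate q n" "1 + 2 * q"] by simp
  also have "\<dots> = real n" by (simp add: a_rate_def powr_powr add_eq_0_iff)
  finally have n: "real n = a_rate q n ^ (1 + 2 * q)" ..
  have "real n * a_rate q n = (a_rate q n ^ (q + 1))\<^sup>2"
    by (subst n) (simp add: power2_eq_square power_add mult_2)
  then have "sqrt (real n * a_rate q n) = a_rate q n ^ (q + 1)"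
    using a by (simp del: power_Suc)
  then show ?thesis
    using a by (simp add: power_mult_distrib power_inverse field_simps)
qed

section \<open>Consistency of the monomial estimator for a general bandwidth\<close>

context prob_space
begin

context
  fixes I :: "real set" and x :: real and \<theta>\<^sub>0 \<Phi>\<^sub>0 :: "real \<Rightarrow> real" and q :: nat
    and \<Gamma> \<Phi> :: "nat \<Rightarrow> 'a \<Rightarrow> real \<Rightarrow> real" and u :: "nat \<Rightarrow> 'a \<Rightarrow> real"
  assumes x: "x \<in> interior I"
    and meas_Gamma: "\<And>n t. t \<in> I \<Longrightarrow> (\<lambda>\<omega>. \<Gamma> n \<omega> t) \<in> borel_measurable M"
    and meas_Phi: "\<And>n t. t \<in> I \<Longrightarrow> (\<lambda>\<omega>. \<Phi> n \<omega> t) \<in> borel_measurable M"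
    and meas_theta [measurable]:
      "\<And>n. (\<lambda>\<omega>. theta_hat I (\<Gamma> n \<omega>) (\<Phi> n \<omega>) (u n \<omega>) x) \<in> borel_measurable M"
begin

lemma eventually_in_domain:
  assumes "\<eta> \<longlonglongrightarrow> 0"
  shows "\<forall>\<^sub>F n in sequentially. x + \<eta> n \<in> I"
proof -
  have "(\<lambda>n. x + \<eta> n) \<longlonglongrightarrow> x" using tendsto_add[OF tendsto_const assms, of x] by simp
  from topological_tendstoD[OF this open_interior x] show ?thesis
    by eventually_elim (use interior_subset in blast)
qed

lemma eventually_measurable_D_MA:
  assumes "\<eta> \<longlonglongrightarrow> 0"
  shows "\<forall>\<^sub>F n in sequentially. (\<lambda>\<omega>. D_MA q I (\<Gamma> n \<omega>) (\<Phi> n \<omega>) (u n \<omega>) x (\<eta> n)) \<in> borel_measurable M"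
  using eventually_in_domain[OF assms]
proof eventually_elim
  case (elim n)
  have xI: "x \<in> I" using x interior_subset by blast
  note [measurable] = meas_Gamma[OF elim] meas_Phi[OF elim] meas_Gamma[OF xI] meas_Phi[OF xI]
  show ?case unfolding D_MA_def Upsilon_hat_def by measurable
qed

text \<open>The estimator splits exactly into noise, the error of \<open>theta_hat\<close> times an
  increment of \<open>\<Phi>\<close>, and the deterministic quotient. The bandwidth is kept general
  so that multiples of \<open>\<epsilon>\<close> can be inserted.\<close>

lemma D_MA_tendsto_in_prob:
  assumes D: "assumption_D M q I \<theta>\<^sub>0 \<Phi>\<^sub>0 x \<Gamma> \<Phi>"
    and rate: "bounded_in_prob M
           (\<lambda>n \<omega>. r_rate q n * (theta_hat I (\<Gamma> n \<omega>) (\<Phi> n \<omega>) (u n \<omega>) x - \<theta>\<^sub>0 x))"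
    and pos: "\<And>n. \<eta> n > 0" and null: "\<eta> \<longlonglongrightarrow> 0"
    and large: "filterlim (\<lambda>n. real n * \<eta> n ^ (1 + 2 * q)) at_top sequentially"
    and q: "1 \<le> q" and diff: "\<Phi>\<^sub>0 differentiable at x"
    and expansion: "((\<lambda>h. (Gamma0 I \<theta>\<^sub>0 \<Phi>\<^sub>0 (x + h) - Gamma0 I \<theta>\<^sub>0 \<Phi>\<^sub>0 x - \<theta>\<^sub>0 x * (\<Phi>\<^sub>0 (x + h) - \<Phi>\<^sub>0 x)) /
            h ^ (q + 1)) \<longlongrightarrow> d) (at_right 0)"
  shows "tendsto_in_prob M (\<lambda>n \<omega>. D_MA q I (\<Gamma> n \<omega>) (\<Phi> n \<omega>) (u n \<omega>) x (\<eta> n)) d"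
proof -
  let ?z = "\<lambda>n. real n * \<eta> n ^ (1 + 2 * q)"
  have xI: "x \<in> I" using x interior_subset by blast
  have ev1: "\<forall>\<^sub>F n in sequentially. 1 \<le> n" by (rule eventually_ge_at_top)
  have evI: "\<forall>\<^sub>F n in sequentially. x + \<eta> n \<in> I" by (rule eventually_in_domain[OF null])
  have right: "filterlim \<eta> (at_right 0) sequentially"
    using null pos by (auto simp: filterlim_at intro!: always_eventually less_imp_neq[symmetric])

  \<comment> \<open>The product \<open>a_rate q n * \<eta> n\<close> diverges, so the rate condition
    of \<open>assumption_D\<close> holds with limit 0.\<close>
  have "(\<lambda>n. inverse (a_rate q n) * inverse (\<eta> n)) \<longlonglongrightarrow> 0"
  proof (rule Lim_transform_eventually)
    show "(\<lambda>n. ?z n powr (- (1 / (1 + 2 * real q)))) \<longlonglongrightarrow> 0"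
      by (rule tendsto_neg_powr[OF _ large]) simp
    show "\<forall>\<^sub>F n in sequentially. ?z n powr (- (1 / (1 + 2 * real q))) = inverse (a_rate q n) * inverse (\<eta> n)"
      using ev1
      by eventually_elim
        (simp only: powr_minus rate_times_bandwidth(3)[OF pos, symmetric] inverse_mult_distrib)
  qed
  then have "(\<lambda>n. inverse (a_rate q n) * inverse (\<eta> n)) \<in> O(\<lambda>_. 1)"
    by (intro bigoI_tendsto[where c=0]) auto
  then have G: "bounded_in_prob M (\<lambda>n \<omega>. G_hat I \<theta>\<^sub>0 \<Phi>\<^sub>0 x n (\<Gamma> n \<omega>) (\<Phi> n \<omega>) 1 (\<eta> n))"
    and R: "bounded_in_prob M (\<lambda>n \<omega>. R_hat \<Phi>\<^sub>0 x (\<Phi> n \<omega>) 1 (\<eta> n))"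
    using D pos null unfolding assumption_D_def by blast+

  let ?G = "\<lambda>n \<omega>. G_hat I \<theta>\<^sub>0 \<Phi>\<^sub>0 x n (\<Gamma> n \<omega>) (\<Phi> n \<omega>) 1 (\<eta> n)"
  let ?R = "\<lambda>n \<omega>. R_hat \<Phi>\<^sub>0 x (\<Phi> n \<omega>) 1 (\<eta> n)"
  let ?T = "\<lambda>n \<omega>. r_rate q n * (theta_hat I (\<Gamma> n \<omega>) (\<Phi> n \<omega>) (u n \<omega>) x - \<theta>\<^sub>0 x)"
  \<comment> \<open>The factors \<open>?g\<close> and \<open>?b\<close> undo the scalings of
    \<open>?G\<close> and \<open>?T\<close> and supply the division by
    \<open>\<eta> n ^ (q + 1)\<close>. In \<open>?b\<close> one power of \<open>\<eta> n\<close> is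
    missing because \<open>?R + ?e\<close> is the increment of the estimated \<open>\<Phi>\<close>
    already divided by \<open>\<eta> n\<close>; its sign comes from the minus in
    \<open>Upsilon_hat\<close>.\<close>
  let ?g = "\<lambda>n. inverse (sqrt (real n / \<eta> n) * \<eta> n ^ (q + 1))"
  let ?b = "\<lambda>n. - inverse (r_rate q n * \<eta> n ^ q)"
  let ?e = "\<lambda>n. (\<Phi>\<^sub>0 (x + \<eta> n) - \<Phi>\<^sub>0 x) / \<eta> n"
  let ?d = "\<lambda>n. (Gamma0 I \<theta>\<^sub>0 \<Phi>\<^sub>0 (x + \<eta> n) - Gamma0 I \<theta>\<^sub>0 \<Phi>\<^sub>0 x - \<theta>\<^sub>0 x * (\<Phi>\<^sub>0 (x + \<eta> n) - \<Phi>\<^sub>0 x)) /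
      \<eta> n ^ (q + 1)"
  have mG: "\<forall>\<^sub>F n in sequentially. ?G n \<in> borel_measurable M"
    using evI
  proof eventually_elim
    case (elim n)
    note [measurable] = meas_Gamma[OF elim] meas_Phi[OF elim] meas_Gamma[OF xI] meas_Phi[OF xI]
    show ?case unfolding G_hat_def mult_1 by measurable
  qed
  have mR: "\<forall>\<^sub>F n in sequentially. ?R n \<in> borel_measurable M"
    using evI
  proof eventually_elim
    case (elim n)
    note [measurable] = meas_Phi[OF elim] meas_Phi[OF xI]
    show ?case unfolding R_hat_def mult_1 by measurable
  qed
  have mRe: "\<forall>\<^sub>F n in sequentially. (\<lambda>\<omega>. ?R n \<omega> + ?e n) \<in> borel_measurable M"
    using mR by eventually_elim simp
  have mT: "\<forall>\<^sub>F n in sequentially. ?T n \<in> borel_measurable M"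
    by (intro always_eventually allI) measurable

  have g: "?g \<longlonglongrightarrow> 0"
  proof (rule Lim_transform_eventually)
    show "(\<lambda>n. inverse (sqrt (?z n))) \<longlonglongrightarrow> 0"
      by (intro tendsto_inverse_0_at_top filterlim_compose[OF sqrt_at_top large])
    show "\<forall>\<^sub>F n in sequentially. inverse (sqrt (?z n)) = ?g n"
      using ev1 by eventually_elim (simp only: rate_times_bandwidth(1)[OF pos])
  qed
  have b: "?b \<longlonglongrightarrow> 0"
  proof (rule Lim_transform_eventually)
    have "(\<lambda>n. ?z n powr (- (real q / (1 + 2 * real q)))) \<longlonglongrightarrow> 0"
      by (rule tendsto_neg_powr[OF _ large]) (use q in simp)
    from tendsto_minus[OF this]
    show "(\<lambda>n. - (?z n powr (- (real q / (1 + 2 * real q))))) \<longlonglongrightarrow> 0" by simp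
    show "\<forall>\<^sub>F n in sequentially. - (?z n powr (- (real q / (1 + 2 * real q)))) = ?b n"
      using ev1 by eventually_elim (simp only: powr_minus rate_times_bandwidth(2)[OF pos])
  qed
  \<comment> \<open>The difference quotients converge to the derivative of
    \<open>\<Phi>\<^sub>0\<close> at \<open>x\<close>.\<close>
  have e: "Bseq ?e"
  proof -
    obtain p where "(\<Phi>\<^sub>0 has_real_derivative p) (at x)"
      using diff by (auto simp: real_differentiable_def)
    then have "((\<lambda>h. (\<Phi>\<^sub>0 (x + h) - \<Phi>\<^sub>0 x) / h) \<longlongrightarrow> p) (at_right 0)"
      by (auto simp: DERIV_def filterlim_at_split)
    from filterlim_compose[OF this right] show ?thesis
      by (intro convergent_imp_Bseq convergentI)
  qed
  have d: "?d \<longlonglongrightarrow> d" by (rule filterlim_compose[OF expansion right])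

  have t1: "tendsto_in_prob M (\<lambda>n \<omega>. ?G n \<omega> * ?g n) 0"
    by (rule bounded_in_prob_mult_null[OF G mG g])
  have m1: "\<forall>\<^sub>F n in sequentially. (\<lambda>\<omega>. ?G n \<omega> * ?g n) \<in> borel_measurable M"
    using mG by eventually_elim simp
  have mTR: "\<forall>\<^sub>F n in sequentially. (\<lambda>\<omega>. ?T n \<omega> * (?R n \<omega> + ?e n)) \<in> borel_measurable M"
    using mT mRe by eventually_elim (rule borel_measurable_times)
  have t2: "tendsto_in_prob M (\<lambda>n \<omega>. ?T n \<omega> * (?R n \<omega> + ?e n) * ?b n) 0"
    by (intro bounded_in_prob_mult_null[OF _ mTR b] bounded_in_prob_mult[OF rate mT _ mRe]
        bounded_in_prob_add_Bseq[OF R mR e])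
  have m2: "\<forall>\<^sub>F n in sequentially. (\<lambda>\<omega>. ?T n \<omega> * (?R n \<omega> + ?e n) * ?b n) \<in> borel_measurable M"
    using mTR by eventually_elim (rule borel_measurable_times, auto)
  have t3: "tendsto_in_prob M (\<lambda>n \<omega>. ?G n \<omega> * ?g n + ?T n \<omega> * (?R n \<omega> + ?e n) * ?b n) (0 + 0)"
    by (rule tendsto_in_prob_add[OF t1 m1 t2 m2])
  have m3: "\<forall>\<^sub>F n in sequentially.
      (\<lambda>\<omega>. ?G n \<omega> * ?g n + ?T n \<omega> * (?R n \<omega> + ?e n) * ?b n) \<in> borel_measurable M"
    using m1 m2 by eventually_elim (rule borel_measurable_add)
  have t4: "tendsto_in_prob M (\<lambda>n \<omega>. ?G n \<omega> * ?g n + ?T n \<omega> * (?R n \<omega> + ?e n) * ?b n + ?d n) (0 + 0 + d)"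
    by (rule tendsto_in_prob_add[OF t3 m3 tendsto_in_prob_of_tendsto[OF d]]) simp
  have m4: "\<forall>\<^sub>F n in sequentially.
      (\<lambda>\<omega>. ?G n \<omega> * ?g n + ?T n \<omega> * (?R n \<omega> + ?e n) * ?b n + ?d n) \<in> borel_measurable M"
    using m3 by eventually_elim (rule borel_measurable_add, auto)
  have "\<forall>\<^sub>F n in sequentially. \<forall>\<omega>\<in>space M. D_MA q I (\<Gamma> n \<omega>) (\<Phi> n \<omega>) (u n \<omega>) x (\<eta> n) =
      ?G n \<omega> * ?g n + ?T n \<omega> * (?R n \<omega> + ?e n) * ?b n + ?d n"
    using ev1
  proof eventually_elim
    case (elim n)
    have nz: "\<eta> n \<noteq> 0" "sqrt (real n / \<eta> n) \<noteq> 0" "r_rate q n \<noteq> 0"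
      using pos[of n] elim by (simp_all add: r_rate_def)
    show ?case
    proof
      fix \<omega>
      define s where "s = sqrt (real n / \<eta> n)"
      define h where "h = theta_hat I (\<Gamma> n \<omega>) (\<Phi> n \<omega>) (u n \<omega>) x"
      define G1 where "G1 = \<Gamma> n \<omega> (x + \<eta> n) - \<Gamma> n \<omega> x"
      define P1 where "P1 = \<Phi> n \<omega> (x + \<eta> n) - \<Phi> n \<omega> x"
      define G0 where "G0 = Gamma0 I \<theta>\<^sub>0 \<Phi>\<^sub>0 (x + \<eta> n) - Gamma0 I \<theta>\<^sub>0 \<Phi>\<^sub>0 x"
      define P0 where "P0 = \<Phi>\<^sub>0 (x + \<eta> n) - \<Phi>\<^sub>0 x"
      have "?G n \<omega> = s * (G1 - G0 - \<theta>\<^sub>0 x * (P1 - P0))"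
        by (simp add: G_hat_def s_def G1_def G0_def P1_def P0_def algebra_simps)
      then have 1: "?G n \<omega> * ?g n = (G1 - G0 - \<theta>\<^sub>0 x * (P1 - P0)) / \<eta> n ^ (q + 1)"
        using nz by (simp add: s_def field_simps)
      have "?R n \<omega> + ?e n = P1 / \<eta> n"
        by (simp add: R_hat_def P1_def flip: add_divide_distrib)
      then have 2: "?T n \<omega> * (?R n \<omega> + ?e n) * ?b n = - ((h - \<theta>\<^sub>0 x) * P1) / \<eta> n ^ (q + 1)"
        using nz by (simp add: h_def field_simps)
      have 3: "?d n = (G0 - \<theta>\<^sub>0 x * P0) / \<eta> n ^ (q + 1)"
        by (simp add: G0_def P0_def)
      have "D_MA q I (\<Gamma> n \<omega>) (\<Phi> n \<omega>) (u n \<omega>) x (\<eta> n) = (G1 - h * P1) / \<eta> n ^ (q + 1)"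
        by (simp add: D_MA_def Upsilon_hat_def h_def G1_def P1_def algebra_simps)
      \<comment> \<open>Adding and subtracting \<open>G0\<close>,
        \<open>\<theta>\<^sub>0 x * P1\<close> and \<open>\<theta>\<^sub>0 x * P0\<close> separates
        the three sources.\<close>
      also have "\<dots> = (G1 - G0 - \<theta>\<^sub>0 x * (P1 - P0)) / \<eta> n ^ (q + 1) +
          - ((h - \<theta>\<^sub>0 x) * P1) / \<eta> n ^ (q + 1) + (G0 - \<theta>\<^sub>0 x * P0) / \<eta> n ^ (q + 1)"
        unfolding add_divide_distrib[symmetric] by (simp add: algebra_simps)
      finally show "D_MA q I (\<Gamma> n \<omega>) (\<Phi> n \<omega>) (u n \<omega>) x (\<eta> n) =
          ?G n \<omega> * ?g n + ?T n \<omega> * (?R n \<omega> + ?e n) * ?b n + ?d n"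
        unfolding 1 2 3 .
    qed
  qed
  then have "\<forall>\<^sub>F n in sequentially. \<forall>\<omega>\<in>space M. \<bar>D_MA q I (\<Gamma> n \<omega>) (\<Phi> n \<omega>) (u n \<omega>) x (\<eta> n) - d\<bar> \<le>
      1 * \<bar>?G n \<omega> * ?g n + ?T n \<omega> * (?R n \<omega> + ?e n) * ?b n + ?d n - (0 + 0 + d)\<bar>"
    by eventually_elim simp
  then show ?thesis
    by (rule tendsto_in_prob_dominated[OF t4 m4])
qed

end

end

section \<open>Forward differences as weighted monomial estimators\<close>

text \<open>The top case of the alternating sum contributes \<open>(-1) ^ p * fact p\<close>, which
  cancels the factor \<open>(-1) ^ p / fact p\<close>; the term \<open>k = 0\<close> is zero since
  \<open>p \<ge> 1\<close>.\<close>

lemma sum_forward_difference_weights: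
  "(\<Sum>k=1..p. (-1) ^ (k + p) * real (p choose k) * real k ^ p / fact p) = 1" if "1 \<le> p"
proof -
  have "(\<Sum>k=1..p. (-1) ^ (k + p) * real (p choose k) * real k ^ p / fact p) =
      (\<Sum>k\<le>p. (-1) ^ (k + p) * real (p choose k) * real k ^ p / fact p)"
    using that by (intro sum.mono_neutral_left) (auto simp: not_less_eq_eq power_0_left)
  also have "\<dots> = (-1) ^ p / fact p * (\<Sum>k\<le>p. (-1) ^ k * real (p choose k) * real k ^ p)"
    by (simp add: sum_distrib_left power_add mult_ac)
  also have "\<dots> = 1"
    by (simp add: alternating_sum_binomial_powers flip: power_mult_distrib)
  finally show ?thesis .
qed

text \<open>The weight \<open>real k ^ (q + 1)\<close> compensates the denominator
  \<open>(real k * \<epsilon>) ^ (q + 1)\<close> of the monomial estimator with step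
  \<open>real k * \<epsilon>\<close>.\<close>

lemma D_FD_eq_sum_D_MA:
  assumes "\<epsilon> \<noteq> 0"
  shows "D_FD q I \<Gamma> \<Phi> u x \<epsilon> / fact (q + 1) =
    (\<Sum>k=1..q+1. (-1) ^ (k + (q + 1)) * real ((q + 1) choose k) * real k ^ (q + 1) / fact (q + 1) *
       D_MA q I \<Gamma> \<Phi> u x (real k * \<epsilon>))"
  unfolding D_FD_def D_MA_def sum_divide_distrib
  by (intro sum.cong refl) (use assms in \<open>simp add: power_mult_distrib mult_ac del: power_Suc fact_Suc binomial_Suc_Suc\<close>)

text \<open>The forward difference estimator enters divided by \<open>fact (q + 1)\<close>, since
  the raw quotient has limit \<open>fact (q + 1) * Dq\<close>.\<close>

theorem lemma1:
  fixes M :: "'w measure"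
    and I :: "real set" and x :: real and \<theta>\<^sub>0 \<Phi>\<^sub>0 :: "real \<Rightarrow> real" and q :: nat
    and \<Gamma> \<Phi> :: "nat \<Rightarrow> 'w \<Rightarrow> real \<Rightarrow> real" and u :: "nat \<Rightarrow> 'w \<Rightarrow> real"
    and \<epsilon> :: "nat \<Rightarrow> real" and D :: "nat \<Rightarrow> 'w \<Rightarrow> real"
  assumes "prob_space M"
    and "is_interval I" and "x \<in> interior I"
    and "\<exists>j\<ge>1. (deriv ^^ j) \<theta>\<^sub>0 x \<noteq> 0"
    and "q = (LEAST j. j \<ge> 1 \<and> (deriv ^^ j) \<theta>\<^sub>0 x \<noteq> 0)"
    and "assumption_A q I \<theta>\<^sub>0 \<Phi>\<^sub>0 x"
    and "\<And>n t. t \<in> I \<Longrightarrow> (\<lambda>\<omega>. \<Gamma> n \<omega> t) \<in> borel_measurable M"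
    and "\<And>n t. t \<in> I \<Longrightarrow> (\<lambda>\<omega>. \<Phi> n \<omega> t) \<in> borel_measurable M"
    and "\<And>n. u n \<in> borel_measurable M"
    and "\<And>n. (\<lambda>\<omega>. theta_hat I (\<Gamma> n \<omega>) (\<Phi> n \<omega>) (u n \<omega>) x) \<in> borel_measurable M"
    and "\<And>n \<omega> t. \<omega> \<in> space M \<Longrightarrow> t \<in> I \<Longrightarrow> 0 \<le> \<Phi> n \<omega> t"
    and "\<And>n \<omega>. \<omega> \<in> space M \<Longrightarrow> mono_on I (\<Phi> n \<omega>)"
    and "\<And>n \<omega> t. \<omega> \<in> space M \<Longrightarrow> t \<in> I \<Longrightarrow> continuous (at t within (I \<inter> {t..})) (\<Phi> n \<omega>)"
    and "assumption_D M q I \<theta>\<^sub>0 \<Phi>\<^sub>0 x \<Gamma> \<Phi>"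
    and "bounded_in_prob M
           (\<lambda>n \<omega>. r_rate q n * (theta_hat I (\<Gamma> n \<omega>) (\<Phi> n \<omega>) (u n \<omega>) x - \<theta>\<^sub>0 x))"
    and "\<And>n. \<epsilon> n > 0" and "\<epsilon> \<longlonglongrightarrow> 0"
    and "filterlim (\<lambda>n. real n * \<epsilon> n ^ (1 + 2 * q)) at_top sequentially"
    and "D \<in> {\<lambda>n \<omega>. D_MA q I (\<Gamma> n \<omega>) (\<Phi> n \<omega>) (u n \<omega>) x (\<epsilon> n),
              \<lambda>n \<omega>. D_FD q I (\<Gamma> n \<omega>) (\<Phi> n \<omega>) (u n \<omega>) x (\<epsilon> n) / fact (q + 1)}"
  shows "tendsto_in_prob M D (Dq q \<theta>\<^sub>0 \<Phi>\<^sub>0 x)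
    \<and> (let Mt = (\<lambda>n \<omega> v. D n \<omega> * v ^ (q + 1)) in
         tendsto_in_prob_compacta M
           (\<lambda>n \<omega> v. sqrt (real n * a_rate q n) * Mt n \<omega> (v * inverse (a_rate q n)))
           (\<lambda>v. Dq q \<theta>\<^sub>0 \<Phi>\<^sub>0 x * v ^ (q + 1))
       \<and> (\<exists>c>0. \<forall>K>0. liminf (\<lambda>n. ereal (measure M
              {\<omega> \<in> space M. (INF v\<in>{v. \<bar>v\<bar> > inverse K}. ereal (Mt n \<omega> v))
                             \<ge> ereal (c * inverse (K ^ (q + 1)))})) = 1))"
proof -
  interpret prob_space M by fact
  note expansion = assumption_A_expansion[OF assms(3,4,5,6)]
  let ?Dq = "Dq q \<theta>\<^sub>0 \<Phi>\<^sub>0 x"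
  let ?MA = "\<lambda>k n \<omega>. D_MA q I (\<Gamma> n \<omega>) (\<Phi> n \<omega>) (u n \<omega>) x (real k * \<epsilon> n)"
  have MA: "tendsto_in_prob M (?MA k) ?Dq"
    and MA_meas: "\<forall>\<^sub>F n in sequentially. ?MA k n \<in> borel_measurable M" if k: "1 \<le> k" for k
  proof -
    have null: "(\<lambda>n. real k * \<epsilon> n) \<longlonglongrightarrow> 0"
      using tendsto_mult_left[OF assms(17), of "real k"] by simp
    \<comment> \<open>A multiple \<open>k \<ge> 1\<close> only enlarges the bandwidth, so the
      divergence condition carries over.\<close>
    have "real n * \<epsilon> n ^ (1 + 2 * q) \<le> real n * (real k * \<epsilon> n) ^ (1 + 2 * q)" for n
      using k assms(16)[of n] by (intro mult_left_mono power_mono) auto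
    then have large: "filterlim (\<lambda>n. real n * (real k * \<epsilon> n) ^ (1 + 2 * q)) at_top sequentially"
      by (intro filterlim_at_top_mono[OF assms(18)] always_eventually) blast
    show "tendsto_in_prob M (?MA k) ?Dq"
      by (rule D_MA_tendsto_in_prob[OF assms(3,7,8,10,14,15) _ null large expansion(1,4,5)])
        (use k assms(16) in auto)
    show "\<forall>\<^sub>F n in sequentially. ?MA k n \<in> borel_measurable M"
      by (rule eventually_measurable_D_MA[OF assms(3,7,8,10) null])
  qed
  let ?w = "\<lambda>k. (-1) ^ (k + (q + 1)) * real ((q + 1) choose k) * real k ^ (q + 1) / fact (q + 1)"
  have FD_eq: "(\<lambda>n \<omega>. D_FD q I (\<Gamma> n \<omega>) (\<Phi> n \<omega>) (u n \<omega>) x (\<epsilon> n) / fact (q + 1)) =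
      (\<lambda>n \<omega>. \<Sum>k=1..q+1. ?w k * ?MA k n \<omega>)"
  proof (intro ext)
    fix n \<omega>
    show "D_FD q I (\<Gamma> n \<omega>) (\<Phi> n \<omega>) (u n \<omega>) x (\<epsilon> n) / fact (q + 1) = (\<Sum>k=1..q+1. ?w k * ?MA k n \<omega>)"
      using assms(16)[of n] by (intro D_FD_eq_sum_D_MA) simp
  qed
  have wMA_meas: "\<forall>\<^sub>F n in sequentially. (\<lambda>\<omega>. ?w k * ?MA k n \<omega>) \<in> borel_measurable M"
    if "k \<in> {1..q+1}" for k
    using MA_meas[of k] that by (auto elim: eventually_mono)
  have "tendsto_in_prob M (\<lambda>n \<omega>. \<Sum>k=1..q+1. ?w k * ?MA k n \<omega>) (\<Sum>k=1..q+1. ?w k * ?Dq)"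
  proof (rule tendsto_in_prob_sum)
    fix k assume k: "k \<in> {1..q+1}"
    show "tendsto_in_prob M (\<lambda>n \<omega>. ?w k * ?MA k n \<omega>) (?w k * ?Dq)"
    proof (rule tendsto_in_prob_dominated[OF MA MA_meas])
      show "\<forall>\<^sub>F n in sequentially. \<forall>\<omega>\<in>space M.
          \<bar>?w k * ?MA k n \<omega> - ?w k * ?Dq\<bar> \<le> \<bar>?w k\<bar> * \<bar>?MA k n \<omega> - ?Dq\<bar>"
        by (simp only: abs_mult[symmetric] right_diff_distrib[symmetric]) simp
    qed (use k in auto)
  qed (use wMA_meas in auto)
  also have "(\<Sum>k=1..q+1. ?w k * ?Dq) = ?Dq"
    using sum_forward_difference_weights[of "q + 1"] by (simp only: sum_distrib_right[symmetric] mult_1)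
  finally have FD: "tendsto_in_prob M (\<lambda>n \<omega>. \<Sum>k=1..q+1. ?w k * ?MA k n \<omega>) ?Dq" .
  have "\<forall>\<^sub>F n in sequentially. \<forall>k\<in>{1..q+1}. (\<lambda>\<omega>. ?w k * ?MA k n \<omega>) \<in> borel_measurable M"
    using wMA_meas by (intro eventually_ball_finite) auto
  then have FD_meas: "\<forall>\<^sub>F n in sequentially. (\<lambda>\<omega>. \<Sum>k=1..q+1. ?w k * ?MA k n \<omega>) \<in> borel_measurable M"
    by eventually_elim (rule borel_measurable_sum, rule bspec)
  \<comment> \<open>The monomial choice of \<open>D\<close> is the case
    \<open>k = 1\<close>.\<close>
  have D: "tendsto_in_prob M D ?Dq" and D_meas: "\<forall>\<^sub>F n in sequentially. D n \<in> borel_measurable M"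
    using assms(19) MA[of 1] MA_meas[of 1] FD FD_meas unfolding FD_eq by auto
  have "tendsto_in_prob_compacta M
      (\<lambda>n \<omega> v. sqrt (real n * a_rate q n) * (D n \<omega> * (v * inverse (a_rate q n)) ^ (q + 1)))
      (\<lambda>v. ?Dq * v ^ (q + 1))"
  proof (rule tendsto_in_prob_compacta_scaled[OF D D_meas])
    show "\<forall>\<^sub>F n in sequentially. \<forall>\<omega>\<in>space M. \<forall>v.
        sqrt (real n * a_rate q n) * (D n \<omega> * (v * inverse (a_rate q n)) ^ (q + 1)) = D n \<omega> * v ^ (q + 1)"
      using eventually_ge_at_top[of 1] by eventually_elim (blast intro: sqrt_rate_scaling)
  qed (intro continuous_intros)
  moreover have "\<exists>c>0. \<forall>K>0. liminf (\<lambda>n. ereal (measure M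
      {\<omega> \<in> space M. (INF v\<in>{v. \<bar>v\<bar> > inverse K}. ereal (D n \<omega> * v ^ (q + 1)))
                     \<ge> ereal (c * inverse (K ^ (q + 1)))})) = 1"
  \<comment> \<open>Any constant strictly between 0 and \<open>Dq\<close> would do; the choice is
    independent of \<open>K\<close>.\<close>
  proof (intro exI[of _ "?Dq / 2"] conjI allI impI)
    show "?Dq / 2 > 0" using expansion(3) by simp
    fix K :: real assume K: "K > 0"
    \<comment> \<open>Monotonicity of \<open>\<theta>\<^sub>0\<close> made \<open>q\<close> odd, so
      the limit grows on both sides of the origin.\<close>
    have "even (q + 1)" using expansion(2) by simp
    note iff = le_INF_even_power_iff[OF this \<open>?Dq / 2 > 0\<close> K]
    show "liminf (\<lambda>n. ereal (measure M
        {\<omega> \<in> space M. (INF v\<in>{v. \<bar>v\<bar> > inverse K}. ereal (D n \<omega> * v ^ (q + 1)))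
                       \<ge> ereal (?Dq / 2 * inverse (K ^ (q + 1)))})) = 1"
      unfolding iff using expansion(3) by (intro tendsto_in_prob_liminf_ge[OF D D_meas]) simp
  qed
  ultimately show ?thesis
    using D unfolding Let_def by blast
qed

end
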